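(* Let $d\ge1$, $n\ge1$, and let $\mathcal P_n$ be the set of probability distributions on $[n]$. Equip $\mathcal P_n^d$ with the uniform probability measure (induced from its embedding in $\mathbb R^{dn}$). For $\mathbf n=(n_1,\dots,n_d)\in\mathbb Z_{\ge0}^d$ define $\mathcal E_{\mathbf n}$ recursively by $\mathcal E_{\mathbf n}=0$ if some coordinate of $\mathbf n$ is $0$, and otherwise $$\mathcal E_{\mathbf n}=\frac{\sum_{i=1}^d(n_i-1)\,\mathcal E_{\mathbf n-\mathbf e_i}+C(\mathbf n)}{|\mathbf n|-d+1},\qquad |\mathbf n|=n_1+\cdots+n_d.$$ Then the expected value of $\mathrm{EMD}_d(\bm\mu)$ for $\bm\mu$ random in $\mathcal P_n^d$ equals $\mathcal E_{(n,\dots,n)}$.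
   Context: $[n]=\{1,\dots,n\}$; $\mathbf e_i$ is the $i$-th standard basis vector. $C(\mathbf m)=\min_{i\in[d]}\sum_{j\ne i}|m_i-m_j|$. For $\bm\mu=(\mu_1,\dots,\mu_d)\in\mathcal P_n^d$, $\mathrm{EMD}_d(\bm\mu)=\min_{J\in\mathcal J_{\bm\mu}}\sum_{\mathbf m\in[n]^d}C(\mathbf m)J(\mathbf m)$, where $\mathcal J_{\bm\mu}$ is the set of arrays $J:[n]^d\to\mathbb R_{\ge0}$ with $\sum_{\mathbf m:\,m_i=k}J(\mathbf m)=\mu_i(k)$ for all $i\in[d]$, $k\in[n]$. *)

theory Defs
  imports "HOL-Probability.Probability"
begin

definition emd_cost :: "nat \<Rightarrow> (nat \<Rightarrow> nat) \<Rightarrow> real" where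
  "emd_cost d m = Min ((\<lambda>i. \<Sum>j\<in>{1..d} - {i}. \<bar>real (m i) - real (m j)\<bar>) ` {1..d})"

definition prob_dists :: "nat \<Rightarrow> (nat \<Rightarrow> real) set" where
  "prob_dists n = {p \<in> extensional {1..n}. (\<forall>k\<in>{1..n}. 0 \<le> p k) \<and> (\<Sum>k\<in>{1..n}. p k) = 1}"

definition prob_tuples :: "nat \<Rightarrow> nat \<Rightarrow> (nat \<Rightarrow> nat \<Rightarrow> real) set" where
  "prob_tuples d n = (\<Pi>\<^sub>E i\<in>{1..d}. prob_dists n)"

definition multi_indices :: "nat \<Rightarrow> nat \<Rightarrow> (nat \<Rightarrow> nat) set" where
  "multi_indices d n = (\<Pi>\<^sub>E i\<in>{1..d}. {1..n})"

definition couplings :: "nat \<Rightarrow> nat \<Rightarrow> (nat \<Rightarrow> nat \<Rightarrow> real) \<Rightarrow> ((nat \<Rightarrow> nat) \<Rightarrow> real) set" where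
  "couplings d n \<mu> = {J. (\<forall>m\<in>multi_indices d n. 0 \<le> J m) \<and>
     (\<forall>i\<in>{1..d}. \<forall>k\<in>{1..n}. (\<Sum>m | m \<in> multi_indices d n \<and> m i = k. J m) = \<mu> i k)}"

(* LEAST on the reals is a genuine minimum: it carries information only if the minimum is attained. *)
definition EMD :: "nat \<Rightarrow> nat \<Rightarrow> (nat \<Rightarrow> nat \<Rightarrow> real) \<Rightarrow> real" where
  "EMD d n \<mu> =
     (LEAST c. c \<in> (\<lambda>J. \<Sum>m\<in>multi_indices d n. emd_cost d m * J m) ` couplings d n \<mu>)"

function emd_recursion :: "nat \<Rightarrow> (nat \<Rightarrow> nat) \<Rightarrow> real" where
  "emd_recursion d n =
     (if \<exists>i\<in>{1..d}. n i = 0 then 0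
      else ((\<Sum>i\<in>{1..d}. (real (n i) - 1) * emd_recursion d (n(i := n i - 1))) + emd_cost d n)
           / (real (\<Sum>i\<in>{1..d}. n i) - real d + 1))"
  by pat_completeness auto
termination
proof (relation "Wellfounded.measure (\<lambda>(d, n). \<Sum>i\<in>{1..d}. n i)")
  fix d i :: nat and n :: "nat \<Rightarrow> nat"
  assume "\<not> (\<exists>i\<in>{1..d}. n i = 0)" and i: "i \<in> {1..d}"
  then have "n i > 0" by auto
  then have "(\<Sum>j\<in>{1..d}. (n(i := n i - 1)) j) < (\<Sum>j\<in>{1..d}. n j)"
    using i by (intro sum_strict_mono_ex1) auto
  then show "((d, n(i := n i - 1)), (d, n)) \<in> Wellfounded.measure (\<lambda>(d, n). \<Sum>i\<in>{1..d}. n i)"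
    by simp
qed simp

declare emd_recursion.simps [simp del]

(* The set prob_tuples d n lies in the affine subspace of R^(dn) where every row sums to 1, which has
   dimension d(n-1). That subspace is parametrised affinely by its first n-1 columns; an affine
   parametrisation multiplies the induced Euclidean volume by a constant (here sqrt n ^ d), which
   normalisation removes. *)

definition chart_lebesgue :: "nat \<Rightarrow> nat \<Rightarrow> (nat \<Rightarrow> nat \<Rightarrow> real) measure" where
  "chart_lebesgue d n = (\<Pi>\<^sub>M i\<in>{1..d}. \<Pi>\<^sub>M k\<in>{1..<n}. lborel)"

definition chart :: "nat \<Rightarrow> nat \<Rightarrow> (nat \<Rightarrow> nat \<Rightarrow> real) \<Rightarrow> nat \<Rightarrow> nat \<Rightarrow> real" where
  "chart d n x = (\<lambda>i\<in>{1..d}. \<lambda>k\<in>{1..n}. if k < n then x i k else 1 - (\<Sum>j\<in>{1..<n}. x i j))"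

definition uniform_prob_tuples :: "nat \<Rightarrow> nat \<Rightarrow> (nat \<Rightarrow> nat \<Rightarrow> real) measure" where
  "uniform_prob_tuples d n =
     restrict_space
       (distr (uniform_measure (chart_lebesgue d n) (chart d n -` prob_tuples d n \<inter> space (chart_lebesgue d n)))
          (\<Pi>\<^sub>M i\<in>{1..d}. \<Pi>\<^sub>M k\<in>{1..n}. borel) (chart d n))
       (prob_tuples d n)"

(* The remaining facts confirm that uniform_prob_tuples is the normalised volume on prob_tuples d n:
   a probability measure on the Borel sets of prob_tuples d n, invariant under every translation
   along the affine subspace as long as one stays inside prob_tuples d n. *)

lemma measurable_chart [measurable]:
  "chart d n \<in> chart_lebesgue d n \<rightarrow>\<^sub>M (\<Pi>\<^sub>M i\<in>{1..d}. \<Pi>\<^sub>M k\<in>{1..n}. borel)"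
  unfolding chart_def chart_lebesgue_def
proof (intro measurable_restrict)
  fix i k assume i: "i \<in> {1..d}" and k: "k \<in> {1..n}"
  have *: "(\<lambda>x. x i j) \<in> borel_measurable (\<Pi>\<^sub>M i\<in>{1..d}. \<Pi>\<^sub>M k\<in>{1..<n}. lborel)" if "j \<in> {1..<n}" for j
    using measurable_compose[OF measurable_component_singleton[OF i, of "\<lambda>_. \<Pi>\<^sub>M k\<in>{1..<n}. lborel"]
        measurable_component_singleton[OF that, of "\<lambda>_. lborel"]] by simp
  show "(\<lambda>x. if k < n then x i k else 1 - (\<Sum>j\<in>{1..<n}. x i j))
      \<in> borel_measurable (\<Pi>\<^sub>M i\<in>{1..d}. \<Pi>\<^sub>M k\<in>{1..<n}. lborel)"
    using k * by (cases "k < n") (auto intro!: borel_measurable_diff borel_measurable_sum)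
qed

lemma sets_prob_dists: "prob_dists n \<in> sets (\<Pi>\<^sub>M k\<in>{1..n}. borel)"
proof -
  have "prob_dists n = {p \<in> space (\<Pi>\<^sub>M k\<in>{1..n}. borel). (\<forall>k\<in>{1..n}. 0 \<le> p k) \<and> (\<Sum>k\<in>{1..n}. p k) = 1}"
    by (auto simp: prob_dists_def space_PiM PiE_def)
  also have "\<dots> \<in> sets (\<Pi>\<^sub>M k\<in>{1..n}. borel)"
    by measurable
  finally show ?thesis .
qed

lemma sets_prob_tuples [measurable]:
  "prob_tuples d n \<in> sets (\<Pi>\<^sub>M i\<in>{1..d}. \<Pi>\<^sub>M k\<in>{1..n}. borel)"
  unfolding prob_tuples_def by (intro sets_PiM_I_finite sets_prob_dists) auto

lemma product_sigma_finite_lborel: "product_sigma_finite (\<lambda>_. lborel :: real measure)"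
  by standard

lemma product_sigma_finite_rows:
  fixes n :: nat
  shows
  "product_sigma_finite (\<lambda>_. \<Pi>\<^sub>M k\<in>{1..<n}. lborel :: real measure)"
  unfolding product_sigma_finite_def
  by (intro allI product_sigma_finite.sigma_finite[OF product_sigma_finite_lborel]) simp

lemma emeasure_chart_lebesgue_box:
  assumes "\<And>k. A k \<in> sets borel"
  shows "emeasure (chart_lebesgue d n) (\<Pi>\<^sub>E i\<in>{1..d}. \<Pi>\<^sub>E k\<in>{1..<n}. A k) = (\<Prod>k\<in>{1..<n}. emeasure lborel (A k)) ^ d"
  unfolding chart_lebesgue_def
  using assms
  by (subst product_sigma_finite.emeasure_PiM[OF product_sigma_finite_rows])
     (auto simp: product_sigma_finite.emeasure_PiM[OF product_sigma_finite_lborel] intro!: sets_PiM_I_finite)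

lemma chart_in_prob_tuples_iff:
  assumes "n \<ge> 1"
  shows "chart d n x \<in> prob_tuples d n \<longleftrightarrow>
    (\<forall>i\<in>{1..d}. (\<forall>k\<in>{1..<n}. 0 \<le> x i k) \<and> (\<Sum>k\<in>{1..<n}. x i k) \<le> 1)"
proof -
  have split: "{1..n} = insert n {1..<n}" using assms by auto
  have sum: "(\<Sum>k\<in>{1..n}. (\<lambda>k\<in>{1..n}. if k < n then f k else 1 - sum f {1..<n}) k) = 1"
    for f :: "nat \<Rightarrow> real"
  proof -
    have "(\<Sum>k\<in>{1..n}. (\<lambda>k\<in>{1..n}. if k < n then f k else 1 - sum f {1..<n}) k)
       = (\<Sum>k\<in>insert n {1..<n}. if k < n then f k else 1 - sum f {1..<n})"
      unfolding split by (intro sum.cong) auto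
    then show ?thesis by simp
  qed
  have "(\<lambda>k\<in>{1..n}. if k < n then f k else 1 - sum f {1..<n}) \<in> prob_dists n \<longleftrightarrow>
      (\<forall>k\<in>{1..<n}. 0 \<le> f k) \<and> sum f {1..<n} \<le> 1" for f :: "nat \<Rightarrow> real"
  proof -
    have "(\<forall>k\<in>{1..n}. 0 \<le> (\<lambda>k\<in>{1..n}. if k < n then f k else 1 - sum f {1..<n}) k) \<longleftrightarrow>
        (\<forall>k\<in>insert n {1..<n}. 0 \<le> (if k < n then f k else 1 - sum f {1..<n}))"
      unfolding split by (intro ball_cong) auto
    then show ?thesis unfolding prob_dists_def using sum[of f] by auto
  qed
  then show ?thesis
    unfolding prob_tuples_def chart_def by (simp add: PiE_iff)
qed

lemma emeasure_chart_domain: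
  fixes d n :: nat
  assumes "n \<ge> 1"
  defines "S \<equiv> chart d n -` prob_tuples d n \<inter> space (chart_lebesgue d n)"
  shows "S \<in> sets (chart_lebesgue d n)" "emeasure (chart_lebesgue d n) S \<noteq> 0"
    "emeasure (chart_lebesgue d n) S \<noteq> \<infinity>"
proof -
  show S: "S \<in> sets (chart_lebesgue d n)" unfolding S_def by measurable
  let ?B = "\<lambda>c. \<Pi>\<^sub>E i\<in>{1..d}. \<Pi>\<^sub>E k\<in>{1..<n}. {0..c}"
  have sets: "?B c \<in> sets (chart_lebesgue d n)" for c :: real
    unfolding chart_lebesgue_def by (intro sets_PiM_I_finite) auto
  have B: "emeasure (chart_lebesgue d n) (?B c) = (ennreal c ^ (n - 1)) ^ d" if "c \<ge> 0" for c :: real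
    using that by (subst emeasure_chart_lebesgue_box) auto
  have "?B (1 / real n) \<subseteq> S"
  proof
    fix x assume x: "x \<in> ?B (1 / real n)"
    have "(\<Sum>k\<in>{1..<n}. x i k) \<le> 1" if "i \<in> {1..d}" for i
    proof -
      have "(\<Sum>k\<in>{1..<n}. x i k) \<le> (\<Sum>k\<in>{1..<n}. 1 / real n)"
        using x that by (intro sum_mono) (auto simp: PiE_iff)
      also have "\<dots> \<le> 1" using assms by (simp add: field_simps)
      finally show ?thesis .
    qed
    then show "x \<in> S"
      using x subsetD[OF sets.sets_into_space[OF sets] x] assms(1)
      by (auto simp: S_def chart_in_prob_tuples_iff PiE_iff)
  qed
  from emeasure_mono[OF this S] have "(ennreal (1 / real n) ^ (n - 1)) ^ d \<le> emeasure (chart_lebesgue d n) S"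
    by (subst (asm) B) auto
  moreover have "(ennreal (1 / real n) ^ (n - 1)) ^ d \<noteq> 0" using assms by simp
  ultimately show "emeasure (chart_lebesgue d n) S \<noteq> 0" by auto
  have "S \<subseteq> ?B 1"
  proof
    fix x assume x: "x \<in> S"
    then have *: "(\<forall>k\<in>{1..<n}. 0 \<le> x i k) \<and> (\<Sum>k\<in>{1..<n}. x i k) \<le> 1" if "i \<in> {1..d}" for i
      using that assms(1) by (auto simp: S_def chart_in_prob_tuples_iff)
    have "x i k \<le> 1" if "i \<in> {1..d}" "k \<in> {1..<n}" for i k
      using member_le_sum[of k "{1..<n}" "x i"] *[OF that(1)] that(2) by fastforce
    then show "x \<in> ?B 1"
      using x * by (auto simp: S_def chart_lebesgue_def space_PiM PiE_iff)
  qed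
  from emeasure_mono[OF this sets] show "emeasure (chart_lebesgue d n) S \<noteq> \<infinity>"
    by (subst (asm) B) (auto simp: top_unique)
qed

lemma space_uniform_prob_tuples: "space (uniform_prob_tuples d n) = prob_tuples d n"
  using sets.sets_into_space[OF sets_prob_tuples[of d n]]
  by (auto simp: uniform_prob_tuples_def space_restrict_space)

lemma sets_uniform_prob_tuples:
  "sets (uniform_prob_tuples d n) = sets (restrict_space (\<Pi>\<^sub>M i\<in>{1..d}. \<Pi>\<^sub>M k\<in>{1..n}. borel) (prob_tuples d n))"
  by (simp add: uniform_prob_tuples_def sets_restrict_space)

lemma emeasure_uniform_prob_tuples:
  assumes "n \<ge> 1" and A: "A \<in> sets (uniform_prob_tuples d n)"
  shows "emeasure (uniform_prob_tuples d n) A =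
    emeasure (chart_lebesgue d n) (chart d n -` A \<inter> space (chart_lebesgue d n)) /
    emeasure (chart_lebesgue d n) (chart d n -` prob_tuples d n \<inter> space (chart_lebesgue d n))"
proof -
  let ?B = "\<Pi>\<^sub>M i\<in>{1..d}. \<Pi>\<^sub>M k\<in>{1..n}. borel :: real measure"
  let ?L = "chart_lebesgue d n"
  let ?S = "chart d n -` prob_tuples d n \<inter> space ?L"
  have A': "A \<in> sets ?B" "A \<subseteq> prob_tuples d n"
    using A sets.Int[OF sets_prob_tuples[of d n]]
    unfolding sets_uniform_prob_tuples sets_restrict_space by blast+
  have m: "chart d n \<in> uniform_measure ?L ?S \<rightarrow>\<^sub>M ?B"
    using measurable_chart by (simp cong: measurable_cong_sets)
  have "emeasure (uniform_prob_tuples d n) A = emeasure (distr (uniform_measure ?L ?S) ?B (chart d n)) A"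
    unfolding uniform_prob_tuples_def using A' sets.Int[OF sets_prob_tuples[of d n] sets.top]
    by (intro emeasure_restrict_space) simp_all
  also have "\<dots> = emeasure (uniform_measure ?L ?S) (chart d n -` A \<inter> space ?L)"
    using A' m by (subst emeasure_distr) auto
  also have "\<dots> = emeasure ?L (?S \<inter> (chart d n -` A \<inter> space ?L)) / emeasure ?L ?S"
    using A' measurable_sets[OF measurable_chart] assms(1)
    by (intro emeasure_uniform_measure emeasure_chart_domain) auto
  also have "?S \<inter> (chart d n -` A \<inter> space ?L) = chart d n -` A \<inter> space ?L"
    using A' by auto
  finally show ?thesis .
qed

lemma prob_space_uniform_prob_tuples:
  assumes "n \<ge> 1"
  shows "prob_space (uniform_prob_tuples d n)"
proof
  let ?S = "chart d n -` prob_tuples d n \<inter> space (chart_lebesgue d n)"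
  have "emeasure (uniform_prob_tuples d n) (space (uniform_prob_tuples d n)) =
      emeasure (chart_lebesgue d n) ?S / emeasure (chart_lebesgue d n) ?S"
    using emeasure_uniform_prob_tuples[OF assms sets.top] by (simp add: space_uniform_prob_tuples)
  also have "\<dots> = 1"
    using emeasure_chart_domain[OF assms] by (intro ennreal_divide_self) (auto simp: top.not_eq_extremum)
  finally show "emeasure (uniform_prob_tuples d n) (space (uniform_prob_tuples d n)) = 1" .
qed

lemma distr_PiM_componentwise:
  assumes M: "product_sigma_finite M" and "finite I"
    and f: "\<And>i. i \<in> I \<Longrightarrow> f i \<in> M i \<rightarrow>\<^sub>M M i" and pres: "\<And>i. i \<in> I \<Longrightarrow> distr (M i) (M i) (f i) = M i"
  shows "distr (Pi\<^sub>M I M) (Pi\<^sub>M I M) (\<lambda>x. \<lambda>i\<in>I. f i (x i)) = Pi\<^sub>M I M"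
proof (rule product_sigma_finite.PiM_eqI[OF M \<open>finite I\<close>])
  fix A assume A: "\<And>i. i \<in> I \<Longrightarrow> A i \<in> sets (M i)"
  have m: "(\<lambda>x. \<lambda>i\<in>I. f i (x i)) \<in> Pi\<^sub>M I M \<rightarrow>\<^sub>M Pi\<^sub>M I M"
  proof (rule measurable_restrict)
    fix i assume i: "i \<in> I"
    show "(\<lambda>x. f i (x i)) \<in> Pi\<^sub>M I M \<rightarrow>\<^sub>M M i"
      by (rule measurable_compose[OF measurable_component_singleton[OF i, of M] f[OF i]])
  qed
  have eq: "(\<lambda>x. \<lambda>i\<in>I. f i (x i)) -` Pi\<^sub>E I A \<inter> space (Pi\<^sub>M I M) = (\<Pi>\<^sub>E i\<in>I. f i -` A i \<inter> space (M i))"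
    by (auto simp: space_PiM PiE_iff)
  have "emeasure (distr (Pi\<^sub>M I M) (Pi\<^sub>M I M) (\<lambda>x. \<lambda>i\<in>I. f i (x i))) (Pi\<^sub>E I A)
      = emeasure (Pi\<^sub>M I M) (\<Pi>\<^sub>E i\<in>I. f i -` A i \<inter> space (M i))"
    using A \<open>finite I\<close> by (subst emeasure_distr[OF m]) (auto simp: eq intro!: sets_PiM_I_finite)
  also have "\<dots> = (\<Prod>i\<in>I. emeasure (M i) (f i -` A i \<inter> space (M i)))"
    using A f by (intro product_sigma_finite.emeasure_PiM[OF M \<open>finite I\<close>]) (auto intro: measurable_sets)
  also have "\<dots> = (\<Prod>i\<in>I. emeasure (M i) (A i))"
  proof (rule prod.cong[OF refl])
    fix i assume i: "i \<in> I"
    then show "emeasure (M i) (f i -` A i \<inter> space (M i)) = emeasure (M i) (A i)"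
      using emeasure_distr[OF f[OF i] A[OF i]] pres[OF i] by simp
  qed
  finally show "emeasure (distr (Pi\<^sub>M I M) (Pi\<^sub>M I M) (\<lambda>x. \<lambda>i\<in>I. f i (x i))) (Pi\<^sub>E I A)
      = (\<Prod>i\<in>I. emeasure (M i) (A i))" .
qed simp

lemma chart_lebesgue_translate:
  "(\<lambda>x. \<lambda>i\<in>{1..d}. \<lambda>k\<in>{1..<n}. v i k + x i k) \<in> chart_lebesgue d n \<rightarrow>\<^sub>M chart_lebesgue d n"
  "distr (chart_lebesgue d n) (chart_lebesgue d n) (\<lambda>x. \<lambda>i\<in>{1..d}. \<lambda>k\<in>{1..<n}. v i k + x i k) = chart_lebesgue d n"
proof -
  let ?R = "\<Pi>\<^sub>M k\<in>{1..<n}. lborel :: real measure"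
  have lb: "distr lborel lborel ((+) c) = lborel" for c :: real
    using lborel_distr_plus[of c] by (simp cong: distr_cong)
  have row: "(\<lambda>y. \<lambda>k\<in>{1..<n}. v i k + y k) \<in> ?R \<rightarrow>\<^sub>M ?R" for i
  proof (rule measurable_restrict)
    fix k assume k: "k \<in> {1..<n}"
    have "(\<lambda>y. y k) \<in> ?R \<rightarrow>\<^sub>M lborel"
      using k by (rule measurable_component_singleton)
    then show "(\<lambda>y. v i k + y k) \<in> ?R \<rightarrow>\<^sub>M lborel" by simp
  qed
  have row': "distr ?R ?R (\<lambda>y. \<lambda>k\<in>{1..<n}. v i k + y k) = ?R" for i
    by (rule distr_PiM_componentwise[OF product_sigma_finite_lborel, of _ "\<lambda>k. (+) (v i k)"]) (auto simp: lb)
  show "(\<lambda>x. \<lambda>i\<in>{1..d}. \<lambda>k\<in>{1..<n}. v i k + x i k) \<in> chart_lebesgue d n \<rightarrow>\<^sub>M chart_lebesgue d n"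
    unfolding chart_lebesgue_def
  proof (rule measurable_restrict)
    fix i assume i: "i \<in> {1..d}"
    have "(\<lambda>x. x i) \<in> (\<Pi>\<^sub>M i\<in>{1..d}. ?R) \<rightarrow>\<^sub>M ?R"
      using i by (rule measurable_component_singleton)
    from measurable_compose[OF this row[of i]]
    show "(\<lambda>x. \<lambda>k\<in>{1..<n}. v i k + x i k) \<in> (\<Pi>\<^sub>M i\<in>{1..d}. ?R) \<rightarrow>\<^sub>M ?R" .
  qed
  show "distr (chart_lebesgue d n) (chart_lebesgue d n) (\<lambda>x. \<lambda>i\<in>{1..d}. \<lambda>k\<in>{1..<n}. v i k + x i k) = chart_lebesgue d n"
    unfolding chart_lebesgue_def
    by (rule distr_PiM_componentwise[OF product_sigma_finite_rows, of _ "\<lambda>i y. \<lambda>k\<in>{1..<n}. v i k + y k"])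
       (use row row' in auto)
qed

lemma emeasure_uniform_prob_tuples_translate:
  fixes d n :: nat
  fixes v :: "nat \<Rightarrow> nat \<Rightarrow> real"
  defines "T \<equiv> \<lambda>\<mu>. \<lambda>i\<in>{1..d}. \<lambda>k\<in>{1..n}. v i k + \<mu> i k"
  assumes n: "n \<ge> 1" and v: "\<And>i. i \<in> {1..d} \<Longrightarrow> (\<Sum>k\<in>{1..n}. v i k) = 0"
    and A: "A \<in> sets (uniform_prob_tuples d n)" and TA: "T ` A \<subseteq> prob_tuples d n"
  shows "emeasure (uniform_prob_tuples d n) (T ` A) = emeasure (uniform_prob_tuples d n) A"
proof -
  let ?B = "\<Pi>\<^sub>M i\<in>{1..d}. \<Pi>\<^sub>M k\<in>{1..n}. borel :: real measure"
  let ?L = "chart_lebesgue d n"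
  define T' where "T' = (\<lambda>\<mu>. \<lambda>i\<in>{1..d}. \<lambda>k\<in>{1..n}. - v i k + \<mu> i k)"
  define U where "U = (\<lambda>x. \<lambda>i\<in>{1..d}. \<lambda>k\<in>{1..<n}. - v i k + x i k)"
  have A': "A \<in> sets ?B" "A \<subseteq> prob_tuples d n"
    using A sets.Int[OF sets_prob_tuples[of d n]]
    unfolding sets_uniform_prob_tuples sets_restrict_space by blast+
  have T'm: "T' \<in> ?B \<rightarrow>\<^sub>M ?B"
    unfolding T'_def
  proof (intro measurable_restrict)
    fix i k assume i: "i \<in> {1..d}" and k: "k \<in> {1..n}"
    have "(\<lambda>x. x i k) \<in> borel_measurable ?B"
      using measurable_compose[OF measurable_component_singleton[OF i, of "\<lambda>_. \<Pi>\<^sub>M k\<in>{1..n}. borel"]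
        measurable_component_singleton[OF k, of "\<lambda>_. borel"]] by simp
    then show "(\<lambda>x. - v i k + x i k) \<in> borel_measurable ?B" by simp
  qed
  have ext: "T (T' \<mu>) = \<mu>" "T' (T \<mu>) = \<mu>" if "\<mu> \<in> space ?B" for \<mu>
  proof -
    have "(\<lambda>i\<in>{1..d}. \<lambda>k\<in>{1..n}. \<mu> i k) = \<mu>"
      using that by (auto simp: space_PiM PiE_iff extensional_def fun_eq_iff restrict_def)
    moreover have "T (T' \<mu>) = (\<lambda>i\<in>{1..d}. \<lambda>k\<in>{1..n}. \<mu> i k)" "T' (T \<mu>) = (\<lambda>i\<in>{1..d}. \<lambda>k\<in>{1..n}. \<mu> i k)"
      by (auto simp: T_def T'_def fun_eq_iff restrict_def)
    ultimately show "T (T' \<mu>) = \<mu>" "T' (T \<mu>) = \<mu>" by simp_all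
  qed
  have AB: "A \<subseteq> space ?B" using sets.sets_into_space[OF A'(1)] .
  have TB: "T \<mu> \<in> space ?B" for \<mu>
    by (auto simp: T_def space_PiM)
  have img: "T ` A = T' -` A \<inter> space ?B"
  proof (intro set_eqI iffI)
    fix y assume "y \<in> T ` A"
    then show "y \<in> T' -` A \<inter> space ?B" using AB TB ext by auto
  next
    fix y assume "y \<in> T' -` A \<inter> space ?B"
    then have "y = T (T' y)" "T' y \<in> A" using ext by auto
    then show "y \<in> T ` A" by blast
  qed
  have TAB: "T ` A \<in> sets ?B" unfolding img by (rule measurable_sets[OF T'm A'(1)])
  then have TAs: "T ` A \<in> sets (uniform_prob_tuples d n)"
    using TA by (auto simp: sets_uniform_prob_tuples sets_restrict_space)
  have comm: "T' (chart d n x) = chart d n (U x)" for x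
  proof -
    have "- v i n + (1 - (\<Sum>j\<in>{1..<n}. x i j)) = 1 - (\<Sum>j\<in>{1..<n}. - v i j + x i j)" if "i \<in> {1..d}" for i
    proof -
      have "{1..n} = insert n {1..<n}" using n by auto
      then have "v i n + (\<Sum>j\<in>{1..<n}. v i j) = 0" using v[OF that] by simp
      then show ?thesis by (simp add: sum.distrib sum_negf sum_subtractf)
    qed
    moreover have "k = n" if "k \<le> n" "\<not> k < n" for k using that by simp
    ultimately show ?thesis
      by (auto simp: T'_def U_def chart_def fun_eq_iff restrict_def intro!: sum.cong)
  qed
  have charts: "chart d n x \<in> space ?B" for x by (auto simp: chart_def space_PiM)
  have Um: "U \<in> ?L \<rightarrow>\<^sub>M ?L" and Ud: "distr ?L ?L U = ?L"
    using chart_lebesgue_translate[where v = "\<lambda>i k. - v i k"] by (simp_all add: U_def)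
  have sets: "chart d n -` A \<inter> space ?L \<in> sets ?L"
    by (rule measurable_sets[OF measurable_chart A'(1)])
  have "chart d n -` (T ` A) \<inter> space ?L = U -` (chart d n -` A \<inter> space ?L) \<inter> space ?L"
    using measurable_space[OF Um] charts by (auto simp: img comm)
  then have "emeasure ?L (chart d n -` (T ` A) \<inter> space ?L) = emeasure ?L (chart d n -` A \<inter> space ?L)"
    using emeasure_distr[OF Um sets] Ud by simp
  then show ?thesis
    by (simp add: emeasure_uniform_prob_tuples[OF n TAs] emeasure_uniform_prob_tuples[OF n A])
qed

end

theory Submission
  imports Defs
begin

text \<open>
  The cost splits over levels: \<open>C(m) = \<Sum>\<^sub>t min(a\<^sub>t, d - a\<^sub>t)\<close>, where \<open>a\<^sub>t\<close> counts the \<open>i\<close> with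
  \<open>m\<^sub>i \<le> t\<close>. Level by level, the comonotone coupling is therefore optimal, so that
  \<open>EMD(\<mu>)\<close> is the integral of \<open>C(q\<^sub>1(u), \<dots>, q\<^sub>d(u))\<close> over \<open>u \<in> (0,1)\<close>, where \<open>q\<^sub>i\<close> is the quantile
  function of \<open>\<mu>\<^sub>i\<close>. For uniformly random \<open>\<mu>\<close> and fixed \<open>u\<close>, the \<open>q\<^sub>i(u) - 1\<close> are independent
  binomial variables with parameters \<open>n - 1\<close> and \<open>u\<close>, so by Fubini the expectation is the
  integral of a combination of products of Bernstein polynomials. With \<open>n\<close> replaced by
  \<open>(n\<^sub>1, \<dots>, n\<^sub>d)\<close>, these integrals satisfy the recursion, because
  \<open>u B'\<^sub>N\<^sub>,\<^sub>k(u) = N (B\<^sub>N\<^sub>,\<^sub>k(u) - B\<^sub>N\<^sub>-\<^sub>1\<^sub>,\<^sub>k(u))\<close>: integrate the derivative of \<open>u\<close> times the product.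
\<close>

section \<open>Integrals of products of Bernstein polynomials\<close>

lemma Bernstein_eq_0: "n < k \<Longrightarrow> Bernstein n k x = 0"
  by (simp add: Bernstein_def)

lemma Bernstein_at_1: "Bernstein n k 1 = (if k = n then 1 else 0)"
  by (simp add: Bernstein_def power_0_left)

text \<open>The usual derivative formula mixes the indices k and k - 1. Multiplied by u, it lowers
  only the degree and keeps k, which matches the step from n to n - e_i with the cell m fixed. The
  derivative is existential because its shape depends on the case, and only u * D matters later. For
  n = 0 the factor \<open>real n\<close> absorbs the truncated n - 1.\<close>

lemma Bernstein_has_derivative:
  "\<exists>D. (Bernstein n k has_real_derivative D) (at u) \<and>
       u * D = real n * (Bernstein n k u - Bernstein (n - 1) k u)"
proof -
  consider "n < k" | "k = n" | "k < n" by linarith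
  then show ?thesis
  proof cases
    case 1
    then have "Bernstein n k = (\<lambda>_. 0)" "Bernstein (n - 1) k u = 0"
      by (auto simp: Bernstein_eq_0)
    then show ?thesis by (auto intro!: exI[of _ 0])
  next
    case 2
    have "(Bernstein n k has_real_derivative real n * u ^ (n - 1)) (at u)"
      unfolding Bernstein_def 2 by (auto intro!: derivative_eq_intros)
    moreover have "u * (real n * u ^ (n - 1)) = real n * (Bernstein n k u - Bernstein (n - 1) k u)"
      by (cases n) (simp_all add: 2 Bernstein_def)
    ultimately show ?thesis by blast
  next
    case 3
    then obtain r where r: "n = Suc (k + r)" using less_iff_Suc_add by auto
    define c where "c = real (n choose k)"
    define c' where "c' = real (k + r choose k)"
    \<comment> \<open>Absorption, (n - k) binom(n, k) = n binom(n - 1, k), from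
      \<open>Suc_times_binomial\<close> after reflecting both coefficients.\<close>
    have cc: "real (Suc r) * c = real n * c'"
    proof -
      have "Suc r * (n choose k) = n * (k + r choose k)"
        using Suc_times_binomial[of r "k + r"] binomial_symmetric[of k n]
          binomial_symmetric[of k "k + r"] r by (simp del: binomial_Suc_Suc)
      then show ?thesis unfolding c_def c'_def by (metis of_nat_mult)
    qed
    let ?D = "c * (real k * u ^ (k - 1) * (1 - u) ^ Suc r - u ^ k * (real (Suc r) * (1 - u) ^ r))"
    have B: "Bernstein n k = (\<lambda>u. c * u ^ k * (1 - u) ^ Suc r)"
      using r by (simp add: Bernstein_def c_def fun_eq_iff)
    have "(Bernstein n k has_real_derivative ?D) (at u)"
      unfolding B by (auto intro!: derivative_eq_intros simp: algebra_simps simp del: power_Suc)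
    moreover have "u * ?D = real n * (Bernstein n k u - Bernstein (n - 1) k u)"
    proof -
      have uk: "u * (real k * u ^ (k - 1)) = real k * u ^ k" by (cases k) auto
      have "u * ?D = c * (u * (real k * u ^ (k - 1))) * (1 - u) ^ Suc r
        - u * u ^ k * (1 - u) ^ r * (real (Suc r) * c)"
        by (simp only: algebra_simps)
      also have "\<dots> = real k * c * u ^ k * (1 - u) ^ Suc r - u * u ^ k * (1 - u) ^ r * (real (Suc r) * c)"
        unfolding uk by simp
      also have "\<dots> = real n * (c * u ^ k * (1 - u) ^ Suc r) - real (Suc r) * c * u ^ k * (1 - u) ^ r"
        using r by (simp add: algebra_simps)
      also have "\<dots> = real n * (Bernstein n k u - Bernstein (n - 1) k u)"
        unfolding cc using r by (simp add: Bernstein_def c_def c'_def algebra_simps)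
      finally show ?thesis .
    qed
    ultimately show ?thesis by blast
  qed
qed

text \<open>The probability that independent binomial variables with parameters n_i - 1 and u take
  the values m_i - 1. The sizes n_i may differ because the recursion leaves the diagonal.\<close>

definition cell_prob :: "nat \<Rightarrow> (nat \<Rightarrow> nat) \<Rightarrow> (nat \<Rightarrow> nat) \<Rightarrow> real \<Rightarrow> real" where
  "cell_prob d n m u = (\<Prod>i\<in>{1..d}. Bernstein (n i - 1) (m i - 1) u)"

lemma continuous_on_cell_prob [continuous_intros]: "continuous_on A (cell_prob d n m)"
  unfolding cell_prob_def Bernstein_def by (intro continuous_intros)

text \<open>By the product rule, factor i contributes n_i - 1 copies of the product itself minus n_i
  - 1 copies of the one for n - e_i. The factor u contributes one more copy, so the copies add up to
  |n| - d + 1, the denominator of the recursion.\<close>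

lemma cell_prob_has_derivative:
  assumes n: "\<And>i. i \<in> {1..d} \<Longrightarrow> n i \<ge> 1"
  shows "((\<lambda>u. u * cell_prob d n m u) has_real_derivative
    (real (\<Sum>i\<in>{1..d}. n i) - real d + 1) * cell_prob d n m u
      - (\<Sum>i\<in>{1..d}. (real (n i) - 1) * cell_prob d (n(i := n i - 1)) m u)) (at u)"
proof -
  define B where "B = (\<lambda>i. Bernstein (n i - 1) (m i - 1))"
  obtain D where D: "\<And>i. (B i has_real_derivative D i) (at u)"
    "\<And>i. u * D i = real (n i - 1) * (B i u - Bernstein (n i - 1 - 1) (m i - 1) u)"
    using Bernstein_has_derivative[of "n i - 1" "m i - 1" u for i] unfolding B_def by metis
  have upd: "cell_prob d (n(i := n i - 1)) m u
      = Bernstein (n i - 1 - 1) (m i - 1) u * (\<Prod>j\<in>{1..d} - {i}. B j u)" if "i \<in> {1..d}" for i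
    unfolding cell_prob_def B_def using that
    by (subst prod.remove[OF _ that]) (auto intro!: prod.cong)
  have full: "cell_prob d n m u = B i u * (\<Prod>j\<in>{1..d} - {i}. B j u)" if "i \<in> {1..d}" for i
    unfolding cell_prob_def B_def using that by (subst prod.remove[OF _ that]) auto
  have "((\<lambda>u. \<Prod>i\<in>{1..d}. B i u) has_real_derivative
      (\<Sum>i\<in>{1..d}. D i * (\<Prod>j\<in>{1..d} - {i}. B j u))) (at u)"
    by (intro has_field_derivative_prod D)
  then have "((\<lambda>u. u * cell_prob d n m u) has_real_derivative
      1 * cell_prob d n m u + (\<Sum>i\<in>{1..d}. D i * (\<Prod>j\<in>{1..d} - {i}. B j u)) * u) (at u)"
    unfolding cell_prob_def B_def by (intro DERIV_mult DERIV_ident)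
  moreover have "(\<Sum>i\<in>{1..d}. D i * (\<Prod>j\<in>{1..d} - {i}. B j u)) * u
     = (\<Sum>i\<in>{1..d}. (real (n i) - 1) * (cell_prob d n m u - cell_prob d (n(i := n i - 1)) m u))"
    unfolding sum_distrib_right
  proof (rule sum.cong[OF refl])
    fix i assume i: "i \<in> {1..d}"
    have "D i * (\<Prod>j\<in>{1..d} - {i}. B j u) * u = (u * D i) * (\<Prod>j\<in>{1..d} - {i}. B j u)"
      by simp
    also have "\<dots> = (real (n i) - 1) * (cell_prob d n m u - cell_prob d (n(i := n i - 1)) m u)"
      unfolding D(2) upd[OF i] full[OF i] using n[OF i] by (simp add: algebra_simps of_nat_diff)
    finally show "D i * (\<Prod>j\<in>{1..d} - {i}. B j u) * u
      = (real (n i) - 1) * (cell_prob d n m u - cell_prob d (n(i := n i - 1)) m u)" .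
  qed
  moreover
  have "real (\<Sum>i\<in>{1..d}. n i) - real d = (\<Sum>i\<in>{1..d}. real (n i) - 1)"
    by (simp add: sum_subtractf)
  then have "(real (\<Sum>i\<in>{1..d}. n i) - real d + 1) * cell_prob d n m u
      - (\<Sum>i\<in>{1..d}. (real (n i) - 1) * cell_prob d (n(i := n i - 1)) m u)
    = 1 * cell_prob d n m u
      + (\<Sum>i\<in>{1..d}. (real (n i) - 1) * (cell_prob d n m u - cell_prob d (n(i := n i - 1)) m u))"
    unfolding right_diff_distrib sum_subtractf sum_distrib_right[symmetric] by (simp add: algebra_simps)
  ultimately show ?thesis by simp
qed

lemma cell_prob_at_1:
  assumes "\<And>i. i \<in> {1..d} \<Longrightarrow> n i \<ge> 1" and "\<And>i. i \<in> {1..d} \<Longrightarrow> m i \<ge> 1"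
  shows "cell_prob d n m 1 = (if \<forall>i\<in>{1..d}. m i = n i then 1 else 0)"
proof (cases "\<forall>i\<in>{1..d}. m i = n i")
  case True
  then show ?thesis by (simp add: cell_prob_def Bernstein_at_1)
next
  case False
  then obtain i where i: "i \<in> {1..d}" "m i \<noteq> n i" by auto
  then have "m i - 1 \<noteq> n i - 1" using assms[of i] by simp
  then have "\<exists>i\<in>{1..d}. Bernstein (n i - 1) (m i - 1) 1 = 0"
    using i by (intro bexI[of _ i]) (auto simp: Bernstein_at_1)
  then show ?thesis using i by (auto simp: cell_prob_def intro!: prod_zero)
qed

text \<open>Fundamental theorem of calculus on [0,1]. The boundary term at 0 vanishes through the
  factor u; the one at 1 singles out m = n and produces the summand C(n) of the recursion once the
  costs are summed over m.\<close>

lemma integral_cell_prob_recursion: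
  assumes n: "\<And>i. i \<in> {1..d} \<Longrightarrow> n i \<ge> 1" and m: "\<And>i. i \<in> {1..d} \<Longrightarrow> m i \<ge> 1"
  shows "(real (\<Sum>i\<in>{1..d}. n i) - real d + 1) * integral {0..1} (cell_prob d n m)
    = (\<Sum>i\<in>{1..d}. (real (n i) - 1) * integral {0..1} (cell_prob d (n(i := n i - 1)) m))
      + (if \<forall>i\<in>{1..d}. m i = n i then 1 else 0)"
proof -
  let ?N = "real (\<Sum>i\<in>{1..d}. n i) - real d + 1"
  have int: "cell_prob d n' m integrable_on {0..1}" for n'
    by (intro integrable_continuous_real continuous_intros)
  have "((\<lambda>u. ?N * cell_prob d n m u
      - (\<Sum>i\<in>{1..d}. (real (n i) - 1) * cell_prob d (n(i := n i - 1)) m u)) has_integral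
      1 * cell_prob d n m 1 - 0 * cell_prob d n m 0) {0..1}"
    using has_field_derivative_at_within[OF cell_prob_has_derivative[OF n]]
    unfolding has_real_derivative_iff_has_vector_derivative
    by (intro fundamental_theorem_of_calculus) simp_all
  moreover have "((\<lambda>u. ?N * cell_prob d n m u
      - (\<Sum>i\<in>{1..d}. (real (n i) - 1) * cell_prob d (n(i := n i - 1)) m u)) has_integral
      ?N * integral {0..1} (cell_prob d n m)
      - (\<Sum>i\<in>{1..d}. (real (n i) - 1) * integral {0..1} (cell_prob d (n(i := n i - 1)) m))) {0..1}"
    by (intro has_integral_diff has_integral_sum has_integral_mult_right integrable_integral int) auto
  ultimately have "1 * cell_prob d n m 1 - 0 * cell_prob d n m 0 = ?N * integral {0..1} (cell_prob d n m)
      - (\<Sum>i\<in>{1..d}. (real (n i) - 1) * integral {0..1} (cell_prob d (n(i := n i - 1)) m))"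
    by (rule has_integral_unique)
  then show ?thesis
    using cell_prob_at_1[OF n m] by simp
qed

section \<open>The recursion solved by integrals of cell probabilities\<close>

lemma emd_cost_cong: "(\<And>i. i \<in> {1..d} \<Longrightarrow> m i = m' i) \<Longrightarrow> emd_cost d m = emd_cost d m'"
  unfolding emd_cost_def by (intro arg_cong[where f = Min] image_cong sum.cong) auto

lemma finite_multi_indices [simp]: "finite (multi_indices d n)"
  unfolding multi_indices_def by (intro finite_PiE) auto

text \<open>The box of side M is the same for every n met in the recursion, so the sums can be
  compared term by term. Indices with some m_i > n_i contribute nothing, their Bernstein factor
  being 0.\<close>

lemma emd_recursion_eq_integral:
  assumes "\<And>i. i \<in> {1..d} \<Longrightarrow> 1 \<le> n i \<and> n i \<le> M"
  shows "emd_recursion d n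
    = (\<Sum>m\<in>multi_indices d M. emd_cost d m * integral {0..1} (cell_prob d n m))"
  using assms
proof (induction d n rule: emd_recursion.induct)
  case (1 d n)
  let ?N = "real (\<Sum>i\<in>{1..d}. n i) - real d + 1"
  let ?E = "\<lambda>n. \<Sum>m\<in>multi_indices d M. emd_cost d m * integral {0..1} (cell_prob d n m)"
  have n: "n i \<ge> 1" "n i \<le> M" if "i \<in> {1..d}" for i using 1(2) that by auto
  then have n0: "\<not> (\<exists>i\<in>{1..d}. n i = 0)" by fastforce
  have "(\<Sum>i\<in>{1..d}. 1) \<le> (\<Sum>i\<in>{1..d}. n i)" using n by (intro sum_mono) auto
  then have "real d \<le> real (\<Sum>i\<in>{1..d}. n i)" by (simp del: of_nat_sum)
  then have N: "?N > 0" by linarith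
  have IH: "(real (n i) - 1) * emd_recursion d (n(i := n i - 1))
      = (real (n i) - 1) * ?E (n(i := n i - 1))" if i: "i \<in> {1..d}" for i
  \<comment> \<open>If n_i = 1, lowering it gives 0, where the induction hypothesis does not apply;
    the coefficient n_i - 1 is then 0.\<close>
  proof (cases "n i = 1")
    case False
    have "emd_recursion d (n(i := n i - 1)) = ?E (n(i := n i - 1))"
    proof (rule 1(1)[OF n0 i])
      fix j assume "j \<in> {1..d}"
      then show "1 \<le> (n(i := n i - 1)) j \<and> (n(i := n i - 1)) j \<le> M"
        using n[of j] False by auto
    qed
    then show ?thesis by simp
  qed simp
  have "?E n * ?N = (\<Sum>m\<in>multi_indices d M. emd_cost d m * (?N * integral {0..1} (cell_prob d n m)))"
    unfolding sum_distrib_right by (intro sum.cong refl) (simp only: mult_ac)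
  also have "\<dots> = (\<Sum>m\<in>multi_indices d M. emd_cost d m *
      ((\<Sum>i\<in>{1..d}. (real (n i) - 1) * integral {0..1} (cell_prob d (n(i := n i - 1)) m))
      + (if \<forall>i\<in>{1..d}. m i = n i then 1 else 0)))"
    using n(1) by (intro sum.cong refl arg_cong2[where f = "(*)"] integral_cell_prob_recursion)
      (auto simp: multi_indices_def)
  also have "\<dots> = (\<Sum>m\<in>multi_indices d M. \<Sum>i\<in>{1..d}.
        (real (n i) - 1) * (emd_cost d m * integral {0..1} (cell_prob d (n(i := n i - 1)) m)))
      + (\<Sum>m\<in>multi_indices d M. if \<forall>i\<in>{1..d}. m i = n i then emd_cost d m else 0)"
    by (simp add: distrib_left sum.distrib sum_distrib_left mult.left_commute
        if_distrib[of "\<lambda>x. emd_cost d _ * x"] cong: if_cong)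
  \<comment> \<open>Members of \<open>multi_indices\<close> are extensional while n is arbitrary
    outside {1..d}, so the single index selected is the restriction of n.\<close>
  also have "(\<Sum>m\<in>multi_indices d M. if \<forall>i\<in>{1..d}. m i = n i then emd_cost d m else 0)
      = (\<Sum>m\<in>multi_indices d M. if m = restrict n {1..d} then emd_cost d m else 0)"
  proof (intro sum.cong refl if_cong)
    fix m assume "m \<in> multi_indices d M"
    then have "m = restrict m {1..d}" by (simp add: multi_indices_def PiE_restrict)
    then show "(\<forall>i\<in>{1..d}. m i = n i) \<longleftrightarrow> m = restrict n {1..d}"
      by (metis restrict_apply restrict_ext)
  qed
  also have "\<dots> = emd_cost d (restrict n {1..d})"
    using n by (subst sum.delta) (auto simp: multi_indices_def intro!: finite_PiE)
  also have "\<dots> = emd_cost d n" by (rule emd_cost_cong) auto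
  also have "(\<Sum>m\<in>multi_indices d M. \<Sum>i\<in>{1..d}.
        (real (n i) - 1) * (emd_cost d m * integral {0..1} (cell_prob d (n(i := n i - 1)) m)))
      = (\<Sum>i\<in>{1..d}. (real (n i) - 1) * ?E (n(i := n i - 1)))"
    unfolding sum_distrib_left by (rule sum.swap)
  also have "\<dots> = (\<Sum>i\<in>{1..d}. (real (n i) - 1) * emd_recursion d (n(i := n i - 1)))"
    by (intro sum.cong refl IH[symmetric])
  finally have "?E n = ((\<Sum>i\<in>{1..d}. (real (n i) - 1) * emd_recursion d (n(i := n i - 1)))
      + emd_cost d n) / ?N"
    by (rule eq_divide_imp[OF less_imp_neq[OF N, symmetric]])
  also have "\<dots> = emd_recursion d n"
    using n0 by (subst emd_recursion.simps[of d n]) (simp only: if_False)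
  finally show ?case by (rule sym)
qed

section \<open>The cost as a sum over levels\<close>

text \<open>The size of the minority among d bits of which a are true: the fewest flips that make
  all bits agree.\<close>

definition imbalance :: "nat \<Rightarrow> nat \<Rightarrow> real" where
  "imbalance d a = min (real a) (real d - real a)"

lemma sum_indicator_dist_eq:
  fixes d :: nat
  shows "(\<Sum>i\<in>{1..d}. \<bar>of_bool (P i) - of_bool b\<bar> :: real)
    = (if b then real d - real (card {i\<in>{1..d}. P i}) else real (card {i\<in>{1..d}. P i}))"
proof -
  have "(\<Sum>i\<in>{1..d}. of_bool (P i) :: real) = real (card {i\<in>{1..d}. P i})"
    by (simp add: of_bool_def sum.If_cases Int_def)
  moreover have "(\<Sum>i\<in>{1..d}. of_bool (\<not> P i) :: real) = real d - real (card {i\<in>{1..d}. P i})"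
  proof -
    have "(\<Sum>i\<in>{1..d}. of_bool (\<not> P i) :: real) = (\<Sum>i\<in>{1..d}. 1 - of_bool (P i))"
      by (intro sum.cong) auto
    then show ?thesis using calculation by (simp add: sum_subtractf)
  qed
  moreover have "\<bar>of_bool (P i) - of_bool b\<bar> = (if b then of_bool (\<not> P i) else of_bool (P i) :: real)" for i
    by auto
  ultimately show ?thesis by simp
qed

lemma imbalance_le:
  "imbalance d (card {i\<in>{1..d}. P i}) \<le> (\<Sum>i\<in>{1..d}. \<bar>of_bool (P i) - of_bool b\<bar>)"
  unfolding sum_indicator_dist_eq imbalance_def by simp

text \<open>The majority bit attains the bound. Counting ties as true makes this bit monotone in the
  count, so that across the levels it switches at a single threshold.\<close>

lemma imbalance_eq:
  "imbalance d (card {i\<in>{1..d}. P i})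
    = (\<Sum>i\<in>{1..d}. \<bar>of_bool (P i) - of_bool (d \<le> 2 * card {i\<in>{1..d}. P i})\<bar>)"
  unfolding sum_indicator_dist_eq imbalance_def by auto

text \<open>The distance of two integers is the number of levels t that separate them.\<close>

lemma abs_diff_eq_sum_levels:
  fixes a b n :: nat
  assumes "a \<in> {1..n}" "b \<in> {1..n}"
  shows "\<bar>real a - real b\<bar> = (\<Sum>t\<in>{1..<n}. \<bar>of_bool (b \<le> t) - of_bool (a \<le> t)\<bar>)"
proof -
  have "(\<Sum>t\<in>{1..<n}. \<bar>of_bool (b \<le> t) - of_bool (a \<le> t)\<bar> :: real)
      = (\<Sum>t\<in>{1..<n}. of_bool (min a b \<le> t \<and> t < max a b))"
    by (intro sum.cong) auto
  also have "\<dots> = real (card ({1..<n} \<inter> {t. min a b \<le> t \<and> t < max a b}))"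
    by (simp add: of_bool_def sum.If_cases)
  also have "{1..<n} \<inter> {t. min a b \<le> t \<and> t < max a b} = {min a b..<max a b}"
    using assms by auto
  finally show ?thesis by (auto simp: min_def max_def)
qed

text \<open>The median index attains the minimum in the cost, and it does so at every level at once.\<close>

lemma emd_cost_eq_sum_imbalance:
  assumes "d \<ge> 1" and m: "\<And>i. i \<in> {1..d} \<Longrightarrow> m i \<in> {1..n}"
  shows "emd_cost d m = (\<Sum>t\<in>{1..<n}. imbalance d (card {i\<in>{1..d}. m i \<le> t}))"
proof -
  define S where "S t = card {i\<in>{1..d}. m i \<le> t}" for t
  have dist: "(\<Sum>j\<in>{1..d} - {i}. \<bar>real (m i) - real (m j)\<bar>)
      = (\<Sum>t\<in>{1..<n}. \<Sum>j\<in>{1..d}. \<bar>of_bool (m j \<le> t) - of_bool (m i \<le> t)\<bar>)" if i: "i \<in> {1..d}" for i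
  proof -
    have "(\<Sum>j\<in>{1..d} - {i}. \<bar>real (m i) - real (m j)\<bar>) = (\<Sum>j\<in>{1..d}. \<bar>real (m i) - real (m j)\<bar>)"
      using i by (intro sum.mono_neutral_left) auto
    also have "\<dots> = (\<Sum>j\<in>{1..d}. \<Sum>t\<in>{1..<n}. \<bar>of_bool (m j \<le> t) - of_bool (m i \<le> t)\<bar>)"
      using i m by (intro sum.cong refl abs_diff_eq_sum_levels) auto
    finally show ?thesis by (subst sum.swap)
  qed
  \<comment> \<open>T is the lower median: the first level at which at least half of the entries lie
    at or below.\<close>
  define T where "T = (LEAST t. d \<le> 2 * S t)"
  have "{i\<in>{1..d}. m i \<le> n} = {1..d}" using m by auto
  then have "S n = d" by (simp add: S_def)
  then have "d \<le> 2 * S n" by simp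
  then have T: "d \<le> 2 * S T" and T_min: "\<And>t. d \<le> 2 * S t \<Longrightarrow> T \<le> t"
    unfolding T_def by (auto intro: LeastI Least_le)
  have S_mono: "S s \<le> S t" if "s \<le> t" for s t
    unfolding S_def using that by (intro card_mono) auto
  have iff: "T \<le> t \<longleftrightarrow> d \<le> 2 * S t" for t
    using T T_min[of t] S_mono[of T t] by auto
  \<comment> \<open>If no entry equalled T, the count at T - 1 would be the same as at T, against
    minimality. T is positive because all entries are at least 1.\<close>
  have "\<exists>i\<in>{1..d}. m i = T"
  proof (rule ccontr)
    assume no: "\<not> (\<exists>i\<in>{1..d}. m i = T)"
    have "T \<noteq> 0"
    proof
      assume "T = 0"
      then have "S 0 \<noteq> 0" using T assms(1) by auto
      moreover have "{i\<in>{1..d}. m i \<le> 0} = {}" using m by force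
      then have "S 0 = 0" unfolding S_def by (simp only: card.empty)
      ultimately show False by simp
    qed
    then have "{i\<in>{1..d}. m i \<le> T} = {i\<in>{1..d}. m i \<le> T - 1}"
      using no by (auto simp: le_less)
    then have "T \<le> T - 1" using T by (intro T_min) (simp add: S_def)
    then show False using \<open>T \<noteq> 0\<close> by simp
  qed
  then obtain i where i: "i \<in> {1..d}" "m i = T" by auto
  have eq: "(\<Sum>j\<in>{1..d} - {i}. \<bar>real (m i) - real (m j)\<bar>) = (\<Sum>t\<in>{1..<n}. imbalance d (S t))"
    unfolding dist[OF i(1)] unfolding i(2) iff S_def imbalance_eq ..
  show ?thesis
    unfolding emd_cost_def S_def[symmetric]
  proof (rule Min_eqI)
    fix y assume "y \<in> (\<lambda>i. \<Sum>j\<in>{1..d} - {i}. \<bar>real (m i) - real (m j)\<bar>) ` {1..d}"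
    then obtain i' where i': "i' \<in> {1..d}" "y = (\<Sum>j\<in>{1..d} - {i'}. \<bar>real (m i') - real (m j)\<bar>)" by auto
    show "(\<Sum>t\<in>{1..<n}. imbalance d (S t)) \<le> y"
      unfolding i'(2) dist[OF i'(1)] S_def by (intro sum_mono imbalance_le)
  qed (use i eq[symmetric] in auto)
qed

section \<open>The comonotone coupling\<close>

definition partial_mass :: "(nat \<Rightarrow> real) \<Rightarrow> nat \<Rightarrow> real" where
  "partial_mass p k = (\<Sum>j\<in>{1..k}. p j)"

definition quantile :: "nat \<Rightarrow> (nat \<Rightarrow> nat \<Rightarrow> real) \<Rightarrow> real \<Rightarrow> nat \<Rightarrow> nat" where
  "quantile d \<mu> u = (\<lambda>i\<in>{1..d}. LEAST k. u < partial_mass (\<mu> i) k)"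

text \<open>The half-open intervals make the cells a partition of (0,1). Membership is phrased by
  partial masses rather than by \<open>quantile\<close>, so that it is a finite system of
  inequalities, measurable jointly in the distributions and u.\<close>

definition quantile_cell :: "nat \<Rightarrow> (nat \<Rightarrow> nat \<Rightarrow> real) \<Rightarrow> (nat \<Rightarrow> nat) \<Rightarrow> real set" where
  "quantile_cell d \<mu> m = {u \<in> {0<..<1}. \<forall>i\<in>{1..d}.
     partial_mass (\<mu> i) (m i - 1) \<le> u \<and> u < partial_mass (\<mu> i) (m i)}"

definition comonotone :: "nat \<Rightarrow> (nat \<Rightarrow> nat \<Rightarrow> real) \<Rightarrow> (nat \<Rightarrow> nat) \<Rightarrow> real" where
  "comonotone d \<mu> m = measure lborel (quantile_cell d \<mu> m)"

lemma partial_mass_0 [simp]: "partial_mass p 0 = 0"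
  by (simp add: partial_mass_def)

lemma partial_mass_pred: "k \<ge> 1 \<Longrightarrow> partial_mass p k = partial_mass p (k - 1) + p k"
  by (cases k) (simp_all add: partial_mass_def)

context
  fixes n :: nat and p :: "nat \<Rightarrow> real"
  assumes p: "p \<in> prob_dists n"
begin

lemma partial_mass_mono: "j \<le> k \<Longrightarrow> k \<le> n \<Longrightarrow> partial_mass p j \<le> partial_mass p k"
  unfolding partial_mass_def using p by (intro sum_mono2) (auto simp: prob_dists_def)

lemma partial_mass_total: "partial_mass p n = 1"
  using p by (simp add: partial_mass_def prob_dists_def)

lemma partial_mass_range: "k \<le> n \<Longrightarrow> partial_mass p k \<in> {0..1}"
  using partial_mass_mono[of 0 k] partial_mass_mono[of k n] partial_mass_total by simp

text \<open>The partial masses increase from 0 to 1, so the t with u below the t-th partial mass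
  form an upper segment of {1..n}. Its least element is the quantile.\<close>

lemma Least_partial_mass:
  assumes u: "u \<in> {0<..<1}"
  shows "(LEAST k. u < partial_mass p k) \<in> {1..n}"
    and "k \<in> {1..n} \<Longrightarrow> partial_mass p (k - 1) \<le> u \<and> u < partial_mass p k
      \<longleftrightarrow> k = (LEAST k. u < partial_mass p k)"
    and "t \<le> n \<Longrightarrow> (LEAST k. u < partial_mass p k) \<le> t \<longleftrightarrow> u < partial_mass p t"
proof -
  let ?k = "LEAST k. u < partial_mass p k"
  have n: "u < partial_mass p n" using partial_mass_total u by simp
  then have k: "u < partial_mass p ?k" by (rule LeastI)
  have "?k \<le> n" using n by (rule Least_le)
  moreover have "?k \<noteq> 0" using k u by (intro notI) simp
  ultimately show range: "?k \<in> {1..n}" by simp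
  show level: "?k \<le> t \<longleftrightarrow> u < partial_mass p t" if "t \<le> n" for t
    using k partial_mass_mono[of ?k t] that by (auto intro: Least_le)
  show "partial_mass p (k - 1) \<le> u \<and> u < partial_mass p k \<longleftrightarrow> k = ?k" if "k \<in> {1..n}" for k
  proof -
    have "k = ?k \<longleftrightarrow> \<not> ?k \<le> k - 1 \<and> ?k \<le> k"
      using that range by auto
    moreover have "k - 1 \<le> n" "k \<le> n" using that by auto
    ultimately show ?thesis using level by (simp add: not_less)
  qed
qed

end

lemma measure_half_open_Int_unit:
  fixes a b :: real
  assumes "0 \<le> a" "a \<le> b" "b \<le> 1"
  shows "measure lborel ({a..<b} \<inter> {0<..<1}) = b - a"
proof (cases "a = 0")
  case True
  then have "{a..<b} \<inter> {0<..<1} = {0<..<b}" using assms by auto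
  then show ?thesis using True assms by simp
next
  case False
  then have "{a..<b} \<inter> {0<..<1} = {a..<b}" using assms by auto
  then show ?thesis using assms by simp
qed

lemma integrable_indicator_unit:
  assumes "A \<in> sets borel" "A \<subseteq> {0<..<1 :: real}"
  shows "integrable lborel (indicator A :: real \<Rightarrow> real)"
proof -
  have "emeasure lborel A \<le> emeasure lborel {0<..<1 :: real}"
    using assms by (intro emeasure_mono) auto
  also have "\<dots> < \<infinity>" by simp
  finally show ?thesis using assms by (intro integrable_real_indicator) auto
qed

lemma sets_quantile_cell [measurable]: "quantile_cell d \<mu> m \<in> sets borel"
proof -
  have "quantile_cell d \<mu> m = {0<..<1} \<inter>
      (\<Inter>i\<in>{1..d}. {partial_mass (\<mu> i) (m i - 1)..<partial_mass (\<mu> i) (m i)})"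
    by (auto simp: quantile_cell_def)
  also have "\<dots> \<in> sets borel" by (cases "d = 0") (auto intro!: sets.finite_INT)
  finally show ?thesis .
qed

lemma quantile_cell_subset: "quantile_cell d \<mu> m \<subseteq> {0<..<1}"
  by (auto simp: quantile_cell_def)

lemma comonotone_nonneg: "comonotone d \<mu> m \<ge> 0"
  by (simp add: comonotone_def)

context
  fixes d n :: nat and \<mu> :: "nat \<Rightarrow> nat \<Rightarrow> real"
  assumes \<mu>: "\<mu> \<in> prob_tuples d n"
begin

lemma row_in_prob_dists: "i \<in> {1..d} \<Longrightarrow> \<mu> i \<in> prob_dists n"
  using \<mu> by (auto simp: prob_tuples_def)

lemma quantile_in_multi_indices: "u \<in> {0<..<1} \<Longrightarrow> quantile d \<mu> u \<in> multi_indices d n"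
  using Least_partial_mass(1)[OF row_in_prob_dists] by (auto simp: quantile_def multi_indices_def)

lemma quantile_cell_iff:
  assumes "m \<in> multi_indices d n"
  shows "u \<in> quantile_cell d \<mu> m \<longleftrightarrow> u \<in> {0<..<1} \<and> m = quantile d \<mu> u"
proof (cases "u \<in> {0<..<1}")
  case True
  have "u \<in> quantile_cell d \<mu> m \<longleftrightarrow> (\<forall>i\<in>{1..d}. m i = (LEAST k. u < partial_mass (\<mu> i) k))"
    using True Least_partial_mass(2)[OF row_in_prob_dists True] assms
    by (auto simp: quantile_cell_def multi_indices_def PiE_iff)
  also have "\<dots> \<longleftrightarrow> m = quantile d \<mu> u"
    using assms by (auto simp: quantile_def multi_indices_def PiE_iff extensional_def fun_eq_iff)
  finally show ?thesis using True by simp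
qed (auto simp: quantile_cell_def)

lemma sum_indicator_quantile_cell:
  "(\<Sum>m\<in>multi_indices d n. g m * indicator (quantile_cell d \<mu> m) u)
    = indicator {0<..<1} u * (g (quantile d \<mu> u) :: real)"
proof (cases "u \<in> {0<..<1}")
  case True
  then have "(\<Sum>m\<in>multi_indices d n. g m * indicator (quantile_cell d \<mu> m) u)
      = (\<Sum>m\<in>multi_indices d n. if m = quantile d \<mu> u then g m else 0)"
    by (intro sum.cong) (auto simp: quantile_cell_iff indicator_def)
  then show ?thesis using True quantile_in_multi_indices[OF True] by (simp add: sum.delta)
qed (auto simp: quantile_cell_def)

text \<open>The comonotone coupling is the law of the quantile vector at a uniform u, so sums
  against it are integrals over u. As exactly one cell contains each u, this reduces to linearity
  over the cell indicators.\<close>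

lemma has_integral_comonotone:
  "has_bochner_integral lborel (\<lambda>u. indicator {0<..<1} u * g (quantile d \<mu> u))
    (\<Sum>m\<in>multi_indices d n. g m * comonotone d \<mu> m)"
  unfolding sum_indicator_quantile_cell[symmetric] comonotone_def
  by (intro has_bochner_integral_sum has_bochner_integral_mult_right)
     (simp add: has_bochner_integral_iff integrable_indicator_unit quantile_cell_subset)

text \<open>The u whose i-th quantile is k fill the interval between the partial masses at k - 1 and
  k, whose length is the required marginal.\<close>

lemma comonotone_coupling: "comonotone d \<mu> \<in> couplings d n \<mu>"
  unfolding couplings_def
proof (intro CollectI conjI ballI comonotone_nonneg)
  fix i k assume i: "i \<in> {1..d}" and k: "k \<in> {1..n}"
  let ?A = "{partial_mass (\<mu> i) (k - 1)..<partial_mass (\<mu> i) k} \<inter> {0<..<1}"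
  have "(\<Sum>m | m \<in> multi_indices d n \<and> m i = k. comonotone d \<mu> m)
      = (\<Sum>m\<in>multi_indices d n. of_bool (m i = k) * comonotone d \<mu> m)"
    by (intro sum.mono_neutral_cong_left) auto
  also have "\<dots> = (LINT u|lborel. indicator {0<..<1} u * of_bool (quantile d \<mu> u i = k))"
    by (rule has_bochner_integral_integral_eq[OF has_integral_comonotone, symmetric])
  also have "\<dots> = (LINT u|lborel. indicator ?A u)"
    using Least_partial_mass(2)[OF row_in_prob_dists[OF i] _ k] i
    by (intro Bochner_Integration.integral_cong) (auto simp: indicator_def quantile_def)
  also have "\<dots> = measure lborel ?A" by simp
  also have "\<dots> = \<mu> i k"
    using partial_mass_range[OF row_in_prob_dists[OF i], of "k - 1"]
      partial_mass_range[OF row_in_prob_dists[OF i], of k]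
      partial_mass_mono[OF row_in_prob_dists[OF i], of "k - 1" k] k partial_mass_pred[of k "\<mu> i"]
    by (subst measure_half_open_Int_unit) auto
  finally show "(\<Sum>m | m \<in> multi_indices d n \<and> m i = k. comonotone d \<mu> m) = \<mu> i k" .
qed

text \<open>Integrates \<open>imbalance_le\<close> over \<open>u\<close>, with the bit \<open>b\<close> chosen as \<open>u < c\<close>.\<close>

lemma comonotone_level_le:
  assumes t: "t \<le> n" and c: "c \<in> {0..1}"
  shows "(\<Sum>m\<in>multi_indices d n. imbalance d (card {i\<in>{1..d}. m i \<le> t}) * comonotone d \<mu> m)
    \<le> (\<Sum>i\<in>{1..d}. \<bar>partial_mass (\<mu> i) t - c\<bar>)"
proof -
  \<comment> \<open>The u in (0,1) at which the bits of coordinate i and of c disagree; its length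
    is the i-th summand of the bound.\<close>
  define A where "A i = {min (partial_mass (\<mu> i) t) c..<max (partial_mass (\<mu> i) t) c} \<inter> {0<..<1}" for i
  have "has_bochner_integral lborel (indicator (A i)) \<bar>partial_mass (\<mu> i) t - c\<bar>" if i: "i \<in> {1..d}" for i
  proof -
    have "measure lborel (A i) = \<bar>partial_mass (\<mu> i) t - c\<bar>"
      unfolding A_def using partial_mass_range[OF row_in_prob_dists[OF i] t] c
      by (subst measure_half_open_Int_unit) auto
    moreover have "integrable lborel (indicator (A i) :: real \<Rightarrow> real)"
      by (intro integrable_indicator_unit) (auto simp: A_def)
    ultimately show ?thesis by (simp add: has_bochner_integral_iff)
  qed
  then have R: "has_bochner_integral lborel (\<lambda>u. \<Sum>i\<in>{1..d}. indicator (A i) u)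
      (\<Sum>i\<in>{1..d}. \<bar>partial_mass (\<mu> i) t - c\<bar>)"
    by (intro has_bochner_integral_sum)
  have le: "indicator {0<..<1} u * imbalance d (card {i\<in>{1..d}. quantile d \<mu> u i \<le> t})
      \<le> (\<Sum>i\<in>{1..d}. indicator (A i) u)" for u
  proof (cases "u \<in> {0<..<1}")
    case True
    have "imbalance d (card {i\<in>{1..d}. quantile d \<mu> u i \<le> t})
        \<le> (\<Sum>i\<in>{1..d}. \<bar>of_bool (quantile d \<mu> u i \<le> t) - of_bool (u < c)\<bar>)"
      by (rule imbalance_le)
    also have "\<dots> = (\<Sum>i\<in>{1..d}. indicator (A i) u)"
    proof (rule sum.cong[OF refl])
      fix i assume i: "i \<in> {1..d}"
      then have "quantile d \<mu> u i \<le> t \<longleftrightarrow> u < partial_mass (\<mu> i) t"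
        using Least_partial_mass(3)[OF row_in_prob_dists[OF i] True t] by (simp add: quantile_def)
      then show "\<bar>of_bool (quantile d \<mu> u i \<le> t) - of_bool (u < c)\<bar> = (indicator (A i) u :: real)"
        using True by (auto simp: A_def indicator_def)
    qed
    finally show ?thesis using True by simp
  qed (simp add: sum_nonneg)
  note L = has_integral_comonotone[of "\<lambda>m. imbalance d (card {i\<in>{1..d}. m i \<le> t})"]
  show ?thesis
    using integral_mono[OF integrable.intros[OF L] integrable.intros[OF R] le]
    unfolding has_bochner_integral_integral_eq[OF L] has_bochner_integral_integral_eq[OF R] .
qed

text \<open>The marginals alone determine the mass of each event m_i <= t, so it is the same for all
  couplings. Split the event by the value of m_i.\<close>

lemma sum_coupling_level:
  assumes J: "J \<in> couplings d n \<mu>" and i: "i \<in> {1..d}" and t: "t \<le> n"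
  shows "(\<Sum>m\<in>multi_indices d n. of_bool (m i \<le> t) * J m) = partial_mass (\<mu> i) t"
proof -
  have "(\<Sum>m\<in>multi_indices d n. of_bool (m i \<le> t) * J m)
      = (\<Sum>m\<in>multi_indices d n. \<Sum>k\<in>{1..t}. of_bool (m i = k) * J m)"
  proof (rule sum.cong[OF refl])
    fix m assume "m \<in> multi_indices d n"
    then have "m i \<ge> 1" using i by (auto simp: multi_indices_def)
    then have "(\<Sum>k\<in>{1..t}. of_bool (m i = k)) = (of_bool (m i \<le> t) :: real)"
      by (simp add: of_bool_def)
    then show "of_bool (m i \<le> t) * J m = (\<Sum>k\<in>{1..t}. of_bool (m i = k) * J m)"
      by (simp flip: sum_distrib_right)
  qed
  also have "\<dots> = (\<Sum>k\<in>{1..t}. \<Sum>m\<in>multi_indices d n. of_bool (m i = k) * J m)"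
    by (rule sum.swap)
  also have "\<dots> = (\<Sum>k\<in>{1..t}. \<Sum>m | m \<in> multi_indices d n \<and> m i = k. J m)"
    by (intro sum.cong refl sum.mono_neutral_cong_right) auto
  also have "\<dots> = partial_mass (\<mu> i) t"
    unfolding partial_mass_def using J i t by (intro sum.cong) (auto simp: couplings_def)
  finally show ?thesis .
qed

text \<open>For another coupling, average the bits that attain the imbalance of each index; their mean
  is the number \<open>c\<close> against which the comonotone coupling is compared.\<close>

lemma comonotone_optimal:
  assumes d: "d \<ge> 1" and J: "J \<in> couplings d n \<mu>"
  shows "(\<Sum>m\<in>multi_indices d n. emd_cost d m * comonotone d \<mu> m)
    \<le> (\<Sum>m\<in>multi_indices d n. emd_cost d m * J m)"
proof -
  let ?S = "\<lambda>t m. card {i\<in>{1..d}. m i \<le> t}"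
  have J0: "J m \<ge> 0" if "m \<in> multi_indices d n" for m
    using J that by (auto simp: couplings_def)
  have J1: "(\<Sum>m\<in>multi_indices d n. J m) = 1"
  proof -
    have one: "1 \<in> {1..d}" using d by simp
    have "(\<Sum>m\<in>multi_indices d n. J m) = (\<Sum>m\<in>multi_indices d n. of_bool (m 1 \<le> n) * J m)"
      using one by (intro sum.cong) (auto simp: multi_indices_def PiE_iff)
    also have "\<dots> = 1"
      by (simp only: sum_coupling_level[OF J one] partial_mass_total[OF row_in_prob_dists[OF one]] le_refl)
    finally show ?thesis .
  qed
  have cost: "(\<Sum>m\<in>multi_indices d n. emd_cost d m * K m)
      = (\<Sum>t\<in>{1..<n}. \<Sum>m\<in>multi_indices d n. imbalance d (?S t m) * K m)" for K
  proof -
    have "(\<Sum>m\<in>multi_indices d n. emd_cost d m * K m)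
        = (\<Sum>m\<in>multi_indices d n. \<Sum>t\<in>{1..<n}. imbalance d (?S t m) * K m)"
    proof (rule sum.cong[OF refl])
      fix m assume "m \<in> multi_indices d n"
      then show "emd_cost d m * K m = (\<Sum>t\<in>{1..<n}. imbalance d (?S t m) * K m)"
        by (subst emd_cost_eq_sum_imbalance[OF d, of m n])
           (auto simp: multi_indices_def sum_distrib_right)
    qed
    then show ?thesis by (subst sum.swap)
  qed
  have "(\<Sum>m\<in>multi_indices d n. imbalance d (?S t m) * comonotone d \<mu> m)
      \<le> (\<Sum>m\<in>multi_indices d n. imbalance d (?S t m) * J m)" if t: "t \<le> n" for t
  proof -
    define b :: "(nat \<Rightarrow> nat) \<Rightarrow> real" where "b m = of_bool (d \<le> 2 * ?S t m)" for m
    define c where "c = (\<Sum>m\<in>multi_indices d n. b m * J m)"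
    have "c \<le> (\<Sum>m\<in>multi_indices d n. 1 * J m)"
      unfolding c_def by (intro sum_mono mult_right_mono J0) (auto simp: b_def)
    moreover have "0 \<le> c" unfolding c_def by (intro sum_nonneg) (auto simp: b_def J0)
    ultimately have "c \<in> {0..1}" using J1 by simp
    then have "(\<Sum>m\<in>multi_indices d n. imbalance d (?S t m) * comonotone d \<mu> m)
        \<le> (\<Sum>i\<in>{1..d}. \<bar>partial_mass (\<mu> i) t - c\<bar>)"
      by (rule comonotone_level_le[OF t])
    also have "\<dots> = (\<Sum>i\<in>{1..d}. \<bar>\<Sum>m\<in>multi_indices d n. (of_bool (m i \<le> t) - b m) * J m\<bar>)"
      unfolding c_def left_diff_distrib sum_subtractf
      by (intro sum.cong refl) (simp only: sum_coupling_level[OF J _ t])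
    \<comment> \<open>Triangle inequality: each difference of means is at most the mean of the bit
      differences. Since \<open>b m\<close> is the majority bit of m, summing over i then gives its
      imbalance.\<close>
    also have "\<dots> \<le> (\<Sum>i\<in>{1..d}. \<Sum>m\<in>multi_indices d n. \<bar>(of_bool (m i \<le> t) - b m) * J m\<bar>)"
      by (intro sum_mono sum_abs)
    also have "\<dots> = (\<Sum>m\<in>multi_indices d n. \<Sum>i\<in>{1..d}. \<bar>of_bool (m i \<le> t) - b m\<bar> * J m)"
      by (subst sum.swap) (intro sum.cong refl, simp add: abs_mult J0)
    also have "\<dots> = (\<Sum>m\<in>multi_indices d n. imbalance d (?S t m) * J m)"
      unfolding imbalance_eq b_def sum_distrib_right ..
    finally show ?thesis .
  qed
  then show ?thesis unfolding cost by (rule sum_mono) simp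
qed

text \<open>The comonotone coupling attains the lower bound, so \<open>LEAST\<close> denotes a
  genuine minimum.\<close>

lemma EMD_eq_comonotone:
  assumes "d \<ge> 1"
  shows "EMD d n \<mu> = (\<Sum>m\<in>multi_indices d n. emd_cost d m * comonotone d \<mu> m)"
  unfolding EMD_def
  by (rule Least_equality) (auto intro: comonotone_coupling comonotone_optimal[OF assms])

end

section \<open>Volumes of the quantile cells\<close>

lemma emeasure_simplex:
  fixes K :: "nat set"
  assumes "finite K" "c \<ge> 0"
  shows "emeasure (\<Pi>\<^sub>M k\<in>K. lborel)
    {y \<in> space (\<Pi>\<^sub>M k\<in>K. lborel). (\<forall>j\<in>K. 0 \<le> y j) \<and> (\<Sum>j\<in>K. y j) \<le> c} = ennreal (c ^ card K / fact (card K))"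
proof -
  have "{y \<in> space (\<Pi>\<^sub>M k\<in>K. lborel). (\<forall>j\<in>K. 0 \<le> y j) \<and> (\<Sum>j\<in>K. y j) \<le> c}
      = {y. (\<forall>j\<in>K. 0 \<le> y j) \<and> sum y K \<le> c} \<inter> space (\<Pi>\<^sub>M k\<in>K. lborel)" by auto
  then show ?thesis using emeasure_std_simplex_aux[OF assms] by simp
qed

text \<open>Translating the k-th coordinate by a turns the set into a simplex of size c. The strict
  inequality a < y k removes only the face \<open>N\<close>, which is null.\<close>

lemma emeasure_shifted_simplex:
  fixes K :: "nat set"
  assumes K: "finite K" "k \<in> K" and "a \<ge> 0" "c \<ge> 0"
  shows "emeasure (\<Pi>\<^sub>M k\<in>K. lborel)
    {y \<in> space (\<Pi>\<^sub>M k\<in>K. lborel). (\<forall>j\<in>K. 0 \<le> y j) \<and> (\<Sum>j\<in>K. y j) \<le> a + c \<and> a < y k}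
    = ennreal (c ^ card K / fact (card K))"
proof -
  let ?R = "\<Pi>\<^sub>M k\<in>K. lborel :: real measure"
  define B where "B = {y \<in> space ?R. (\<forall>j\<in>K. 0 \<le> y j) \<and> (\<Sum>j\<in>K. y j) \<le> a + c \<and> a < y k}"
  define S where "S = {y \<in> space ?R. (\<forall>j\<in>K. 0 \<le> y j) \<and> (\<Sum>j\<in>K. y j) \<le> c}"
  define N where "N = (\<Pi>\<^sub>E j\<in>K. if j = k then {0 :: real} else UNIV)"
  define v where "v j = (if j = k then a else 0)" for j
  define T where "T = (\<lambda>y. \<lambda>j\<in>K. v j + y j)"
  note [measurable] = K(2)
  have lb: "distr lborel lborel ((+) c) = lborel" for c :: real
    using lborel_distr_plus[of c] by (simp cong: distr_cong)
  have T: "T \<in> ?R \<rightarrow>\<^sub>M ?R"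
    unfolding T_def
  proof (rule measurable_restrict)
    fix j assume j: "j \<in> K"
    have "(\<lambda>y. y j) \<in> ?R \<rightarrow>\<^sub>M lborel" using j by (rule measurable_component_singleton)
    then show "(\<lambda>y. v j + y j) \<in> ?R \<rightarrow>\<^sub>M lborel" by simp
  qed
  have dT: "distr ?R ?R T = ?R"
    unfolding T_def
    by (rule distr_PiM_componentwise[OF product_sigma_finite_lborel K(1), of "\<lambda>j. (+) (v j)"]) (auto simp: lb)
  have B: "B \<in> sets ?R" unfolding B_def using K by measurable
  have S: "S \<in> sets ?R" unfolding S_def using K by measurable
  have N: "N \<in> null_sets ?R"
  proof -
    have "emeasure ?R N = (\<Prod>j\<in>K. emeasure lborel (if j = k then {0 :: real} else UNIV))"
      unfolding N_def by (intro product_sigma_finite.emeasure_PiM[OF product_sigma_finite_lborel K(1)]) auto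
    also have "\<dots> = 0" using K by (intro prod_zero) auto
    finally show ?thesis
      unfolding N_def using K by (auto intro!: null_setsI sets_PiM_I_finite)
  qed
  have "T -` B \<inter> space ?R = S - N"
  proof (rule set_eqI)
    fix y
    have "sum (T y) K = a + sum y K"
      using K by (simp add: T_def v_def sum.distrib cong: sum.cong)
    moreover have "(\<forall>j\<in>K. 0 \<le> T y j) \<and> a < T y k \<longleftrightarrow> (\<forall>j\<in>K. 0 \<le> y j) \<and> y k \<noteq> 0"
      using K assms(3) by (fastforce simp: T_def v_def less_le split: if_splits)
    moreover have "y \<in> N \<longleftrightarrow> y k = 0" if "y \<in> space ?R"
      using that K by (auto simp: N_def space_PiM PiE_iff)
    moreover have "T y \<in> space ?R" by (auto simp: T_def space_PiM)
    ultimately show "y \<in> T -` B \<inter> space ?R \<longleftrightarrow> y \<in> S - N"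
      by (auto simp: B_def S_def)
  qed
  then have "emeasure ?R B = emeasure ?R (S - N)"
    using emeasure_distr[OF T B] dT by simp
  also have "\<dots> = emeasure ?R S" by (rule emeasure_Diff_null_set[OF N S])
  finally show ?thesis unfolding B_def S_def using emeasure_simplex[OF K(1) \<open>c \<ge> 0\<close>] by simp
qed

text \<open>The chart coordinates of a single row whose quantile at u is k. For k = n the upper
  inequality is dropped: the full mass 1 exceeds u, and the chart has no n-th coordinate.\<close>

definition simplex_cell :: "nat \<Rightarrow> real \<Rightarrow> nat \<Rightarrow> (nat \<Rightarrow> real) set" where
  "simplex_cell n u k = {x \<in> space (\<Pi>\<^sub>M j\<in>{1..<n}. lborel). (\<forall>j\<in>{1..<n}. 0 \<le> x j) \<and> (\<Sum>j\<in>{1..<n}. x j) \<le> 1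
     \<and> (\<Sum>j\<in>{1..<k}. x j) \<le> u \<and> (k < n \<longrightarrow> u < (\<Sum>j\<in>{1..k}. x j))}"

lemma sets_simplex_cell:
  assumes "k \<in> {1..n}"
  shows "simplex_cell n u k \<in> sets (\<Pi>\<^sub>M j\<in>{1..<n}. lborel)"
proof -
  let ?R = "\<Pi>\<^sub>M j\<in>{1..<n}. lborel :: real measure"
  have sum: "(\<lambda>x. \<Sum>j\<in>K. x j) \<in> borel_measurable ?R" if "K \<subseteq> {1..<n}" for K
    using that by (intro borel_measurable_sum) auto
  have [measurable]: "(\<lambda>x. \<Sum>j\<in>{1..<n}. x j) \<in> borel_measurable ?R"
    "(\<lambda>x. \<Sum>j\<in>{1..<k}. x j) \<in> borel_measurable ?R"
    by (rule sum, use assms in force)+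
  show ?thesis
  proof (cases "k < n")
    case True
    then have [measurable]: "(\<lambda>x. \<Sum>j\<in>{1..k}. x j) \<in> borel_measurable ?R"
      by (intro sum) auto
    show ?thesis unfolding simplex_cell_def using True by measurable
  next
    case False
    then have "k = n" using assms by simp
    show ?thesis unfolding simplex_cell_def \<open>k = n\<close> by simp measurable
  qed
qed

text \<open>The coordinates before \<open>k\<close> fill a simplex of size \<open>u\<close>. Once they are fixed, translating the
  \<open>k\<close>-th coordinate by \<open>u\<close> minus their sum turns the remaining ones into a simplex of size \<open>1 - u\<close>.\<close>

lemma emeasure_simplex_cell:
  assumes k: "k \<in> {1..n}" and u: "u \<in> {0<..<1}"
  shows "emeasure (\<Pi>\<^sub>M j\<in>{1..<n}. lborel) (simplex_cell n u k)
    = ennreal (Bernstein (n - 1) (k - 1) u / fact (n - 1))"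
proof (cases "k < n")
  case False
  then have "k = n" using k by simp
  then have "simplex_cell n u k = {x \<in> space (\<Pi>\<^sub>M j\<in>{1..<n}. lborel).
      (\<forall>j\<in>{1..<n}. 0 \<le> x j) \<and> (\<Sum>j\<in>{1..<n}. x j) \<le> u}"
    using u by (auto simp: simplex_cell_def)
  then show ?thesis
    using emeasure_simplex[of "{1..<n}" u] u \<open>k = n\<close> by (simp add: Bernstein_def)
next
  case True
  let ?I = "{1..<k}" and ?K = "{k..<n}"
  let ?R = "\<lambda>I. \<Pi>\<^sub>M j\<in>I. lborel :: real measure"
  define D where "D = {x \<in> space (?R ?I). (\<forall>j\<in>?I. 0 \<le> x j) \<and> (\<Sum>j\<in>?I. x j) \<le> u}"
  \<comment> \<open>The slice over x, with its bound split as a + c for a = u - sum x and c = 1 - u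
    to fit the shifted simplex.\<close>
  define E where "E x = {y \<in> space (?R ?K). (\<forall>j\<in>?K. 0 \<le> y j)
      \<and> (\<Sum>j\<in>?K. y j) \<le> (u - sum x ?I) + (1 - u) \<and> u - sum x ?I < y k}" for x
  have split: "{1..<n} = ?I \<union> ?K" using k by auto
  have cell: "simplex_cell n u k \<in> sets (?R (?I \<union> ?K))"
    using sets_simplex_cell[OF k, of u] unfolding split .
  have D: "D \<in> sets (?R ?I)" unfolding D_def by measurable
  have E: "E x \<in> sets (?R ?K)" for x
  proof -
    have [measurable]: "k \<in> ?K" using True by simp
    show ?thesis unfolding E_def by measurable
  qed
  have ind: "indicator (simplex_cell n u k) (merge ?I ?K (x, y))
      = (indicator D x * indicator (E x) y :: ennreal)"
    if x: "x \<in> space (?R ?I)" and y: "y \<in> space (?R ?K)" for x y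
  proof -
    let ?z = "merge ?I ?K (x, y)"
    have z: "?z j = (if j < k then x j else y j)" if "j \<in> {1..<n}" for j
      using that by (auto simp: merge_def)
    have "sum ?z ?I = sum x ?I" using True by (intro sum.cong) (auto simp: z)
    moreover have "sum ?z ?K = sum y ?K" using k by (intro sum.cong) (auto simp: z)
    moreover have "sum ?z {1..<n} = sum ?z ?I + sum ?z ?K"
      unfolding split by (intro sum.union_disjoint) auto
    moreover have "sum ?z {1..k} = sum ?z ?I + y k"
    proof -
      have "{1..k} = insert k ?I" using k by auto
      then show ?thesis using z[of k] True k by simp
    qed
    moreover have "?z \<in> space (?R {1..<n})"
      unfolding split by (simp add: space_PiM PiE_def)
    moreover have "(\<forall>j\<in>{1..<n}. 0 \<le> ?z j) \<longleftrightarrow> (\<forall>j\<in>?I. 0 \<le> x j) \<and> (\<forall>j\<in>?K. 0 \<le> y j)"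
      unfolding split by (auto simp: merge_def)
    ultimately have "?z \<in> simplex_cell n u k \<longleftrightarrow> x \<in> D \<and> y \<in> E x"
      using x y True by (auto simp: simplex_cell_def D_def E_def)
    then show ?thesis by (simp add: indicator_def)
  qed
  have "emeasure (?R {1..<n}) (simplex_cell n u k)
      = (\<integral>\<^sup>+ z. indicator (simplex_cell n u k) z \<partial>?R (?I \<union> ?K))"
    unfolding split using cell by (rule nn_integral_indicator[symmetric])
  also have "\<dots> = (\<integral>\<^sup>+ x. \<integral>\<^sup>+ y. indicator (simplex_cell n u k) (merge ?I ?K (x, y)) \<partial>?R ?K \<partial>?R ?I)"
    by (intro product_sigma_finite.product_nn_integral_fold[OF product_sigma_finite_lborel]
        borel_measurable_indicator cell) auto
  also have "\<dots> = (\<integral>\<^sup>+ x. \<integral>\<^sup>+ y. indicator D x * indicator (E x) y \<partial>?R ?K \<partial>?R ?I)"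
    by (intro nn_integral_cong ind)
  also have "\<dots> = (\<integral>\<^sup>+ x. indicator D x * emeasure (?R ?K) (E x) \<partial>?R ?I)"
    using E by (intro nn_integral_cong) (simp add: nn_integral_cmult)
  also have "\<dots> = (\<integral>\<^sup>+ x. ennreal ((1 - u) ^ (n - k) / fact (n - k)) * indicator D x \<partial>?R ?I)"
  proof (intro nn_integral_cong)
    fix x
    have "emeasure (?R ?K) (E x) = ennreal ((1 - u) ^ card ?K / fact (card ?K))" if "x \<in> D"
      unfolding E_def using that True u
      by (intro emeasure_shifted_simplex) (auto simp: D_def)
    then show "indicator D x * emeasure (?R ?K) (E x)
        = ennreal ((1 - u) ^ (n - k) / fact (n - k)) * indicator D x"
      by (auto simp: indicator_def)
  qed
  also have "\<dots> = ennreal ((1 - u) ^ (n - k) / fact (n - k)) * ennreal (u ^ (k - 1) / fact (k - 1))"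
    using D u emeasure_simplex[of ?I u] by (simp add: nn_integral_cmult_indicator D_def)
  also have "\<dots> = ennreal ((1 - u) ^ (n - k) / fact (n - k) * (u ^ (k - 1) / fact (k - 1)))"
    using u by (intro ennreal_mult[symmetric]) auto
  also have "(1 - u) ^ (n - k) / fact (n - k) * (u ^ (k - 1) / fact (k - 1))
      = Bernstein (n - 1) (k - 1) u / fact (n - 1)"
    using k True by (simp add: Bernstein_def binomial_fact mult_ac)
  finally show ?thesis .
qed

section \<open>The law of the quantile vector of a random tuple\<close>

lemma partial_mass_chart:
  assumes "i \<in> {1..d}" "k \<le> n"
  shows "partial_mass (chart d n x i) k = (if k < n then \<Sum>j\<in>{1..k}. x i j else if n = 0 then 0 else 1)"
proof (cases "k < n")
  case True
  then show ?thesis using assms by (auto simp: partial_mass_def chart_def intro!: sum.cong)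
next
  case False
  then have "k = n" using assms by simp
  show ?thesis
  proof (cases "n = 0")
    case n: False
    have "{1..n} = insert n {1..<n}" using n by auto
    then have "partial_mass (chart d n x i) n = chart d n x i n + (\<Sum>j\<in>{1..<n}. chart d n x i j)"
      by (simp add: partial_mass_def)
    also have "(\<Sum>j\<in>{1..<n}. chart d n x i j) = (\<Sum>j\<in>{1..<n}. x i j)"
      using assms by (intro sum.cong) (auto simp: chart_def)
    also have "chart d n x i n = 1 - (\<Sum>j\<in>{1..<n}. x i j)"
      using assms n by (simp add: chart_def)
    finally show ?thesis using \<open>k = n\<close> n by simp
  qed (use \<open>k = n\<close> in simp)
qed

lemma measurable_partial_mass:
  assumes i: "i \<in> {1..d}" and k: "k \<le> n"
  shows "(\<lambda>\<mu>. partial_mass (\<mu> i) k) \<in> borel_measurable (uniform_prob_tuples d n)"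
proof -
  have comp: "(\<lambda>\<mu>. \<mu> i j) \<in> borel_measurable (\<Pi>\<^sub>M i\<in>{1..d}. \<Pi>\<^sub>M k\<in>{1..n}. borel)" if j: "j \<in> {1..n}" for j
    using measurable_compose[OF measurable_component_singleton[OF i, of "\<lambda>_. \<Pi>\<^sub>M k\<in>{1..n}. borel"]
        measurable_component_singleton[OF j, of "\<lambda>_. borel"]] by simp
  have "(\<lambda>\<mu>. partial_mass (\<mu> i) k) \<in> borel_measurable (\<Pi>\<^sub>M i\<in>{1..d}. \<Pi>\<^sub>M k\<in>{1..n}. borel)"
    unfolding partial_mass_def by (intro borel_measurable_sum comp) (use k in auto)
  then show ?thesis
    using measurable_cong_sets[OF sets_uniform_prob_tuples refl] measurable_restrict_space1 by blast
qed

text \<open>Joint measurability in the distributions and u, as needed to exchange the two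
  integrals.\<close>

lemma sets_quantile_graph:
  assumes m: "m \<in> multi_indices d n"
  shows "{(\<mu>, u). \<mu> \<in> prob_tuples d n \<and> u \<in> quantile_cell d \<mu> m} \<in> sets (uniform_prob_tuples d n \<Otimes>\<^sub>M lborel)"
proof -
  let ?M = "uniform_prob_tuples d n"
  have mi: "m i \<le> n" "m i - 1 \<le> n" if "i \<in> {1..d}" for i
    using m that by (auto simp: multi_indices_def PiE_iff intro: le_trans[OF diff_le_self])
  have meas: "(\<lambda>z. partial_mass (fst z i) k) \<in> borel_measurable (?M \<Otimes>\<^sub>M lborel)"
    if "i \<in> {1..d}" "k \<le> n" for i k
    by (rule measurable_compose[OF measurable_fst measurable_partial_mass[OF that]])
  have snd: "snd \<in> borel_measurable (?M \<Otimes>\<^sub>M (lborel :: real measure))"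
    using measurable_snd[of ?M "lborel :: real measure"] by simp
  have "{z \<in> space (?M \<Otimes>\<^sub>M lborel). (0 < snd z \<and> snd z < 1) \<and> (\<forall>i\<in>{1..d}.
      partial_mass (fst z i) (m i - 1) \<le> snd z \<and> snd z < partial_mass (fst z i) (m i))}
      \<in> sets (?M \<Otimes>\<^sub>M lborel)"
    by (intro sets.sets_Collect_conj sets.sets_Collect_finite_All borel_measurable_le
        borel_measurable_less meas snd mi borel_measurable_const finite_atLeastAtMost)
  also have "{z \<in> space (?M \<Otimes>\<^sub>M lborel). (0 < snd z \<and> snd z < 1) \<and> (\<forall>i\<in>{1..d}.
      partial_mass (fst z i) (m i - 1) \<le> snd z \<and> snd z < partial_mass (fst z i) (m i))}
      = {(\<mu>, u). \<mu> \<in> prob_tuples d n \<and> u \<in> quantile_cell d \<mu> m}"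
    by (auto simp: space_pair_measure space_uniform_prob_tuples quantile_cell_def)
  finally show ?thesis .
qed

text \<open>In the chart both the event and the whole domain are products over the rows. Each row
  contributes a Bernstein value over (n - 1)! divided by the simplex volume 1 / (n - 1)!, so the
  factorials cancel.\<close>

lemma emeasure_quantile_cell:
  assumes n: "n \<ge> 1" and m: "m \<in> multi_indices d n" and u: "u \<in> {0<..<1}"
  shows "emeasure (uniform_prob_tuples d n) {\<mu> \<in> prob_tuples d n. u \<in> quantile_cell d \<mu> m}
    = ennreal (cell_prob d (\<lambda>_. n) m u)"
proof -
  let ?A = "{\<mu> \<in> prob_tuples d n. u \<in> quantile_cell d \<mu> m}"
  let ?R = "\<Pi>\<^sub>M j\<in>{1..<n}. lborel :: real measure"
  let ?L = "chart_lebesgue d n"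
  let ?S = "{x \<in> space ?R. (\<forall>j\<in>{1..<n}. 0 \<le> x j) \<and> (\<Sum>j\<in>{1..<n}. x j) \<le> 1}"
  have mi: "m i \<in> {1..n}" if "i \<in> {1..d}" for i
    using m that by (auto simp: multi_indices_def)
  have A: "?A \<in> sets (uniform_prob_tuples d n)"
    using sets_Pair2[OF sets_quantile_graph[OF m], of u] by (simp add: vimage_def)
  have spaceL: "x \<in> space ?L \<longleftrightarrow> x \<in> extensional {1..d} \<and> (\<forall>i\<in>{1..d}. x i \<in> space ?R)" for x
    by (auto simp: chart_lebesgue_def space_PiM PiE_iff)
  have "chart d n -` prob_tuples d n \<inter> space ?L = (\<Pi>\<^sub>E i\<in>{1..d}. ?S)"
    by (rule set_eqI) (simp add: chart_in_prob_tuples_iff[OF n] spaceL PiE_iff, blast)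
  moreover have "emeasure ?L (\<Pi>\<^sub>E i\<in>{1..d}. ?S) = (\<Prod>i\<in>{1..d}. emeasure ?R ?S)"
    unfolding chart_lebesgue_def
    by (intro product_sigma_finite.emeasure_PiM[OF product_sigma_finite_rows]) auto
  moreover have "emeasure ?R ?S = ennreal (1 / fact (n - 1))"
    using emeasure_simplex[of "{1..<n}" 1] by simp
  ultimately have total: "emeasure ?L (chart d n -` prob_tuples d n \<inter> space ?L)
      = ennreal (\<Prod>i\<in>{1..d}. 1 / fact (n - 1))"
    by (simp add: ennreal_power)
  have cell: "partial_mass (chart d n x i) (m i - 1) \<le> u \<and> u < partial_mass (chart d n x i) (m i) \<longleftrightarrow>
      sum (x i) {1..<m i} \<le> u \<and> (m i < n \<longrightarrow> u < sum (x i) {1..m i})" if i: "i \<in> {1..d}" for x i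
  proof -
    have "{1..m i - 1} = {1..<m i}" "m i - 1 < n" "m i - 1 \<le> n" using mi[OF i] by auto
    then show ?thesis using mi[OF i] u n by (simp add: partial_mass_chart[OF i])
  qed
  have "chart d n -` ?A \<inter> space ?L = (\<Pi>\<^sub>E i\<in>{1..d}. simplex_cell n u (m i))"
  proof (rule set_eqI)
    fix x
    have "x \<in> chart d n -` ?A \<inter> space ?L \<longleftrightarrow> x \<in> space ?L \<and> chart d n x \<in> prob_tuples d n \<and> (\<forall>i\<in>{1..d}.
        partial_mass (chart d n x i) (m i - 1) \<le> u \<and> u < partial_mass (chart d n x i) (m i))"
      using u by (auto simp: quantile_cell_def)
    also have "\<dots> \<longleftrightarrow> x \<in> space ?L \<and> chart d n x \<in> prob_tuples d n \<and> (\<forall>i\<in>{1..d}.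
        sum (x i) {1..<m i} \<le> u \<and> (m i < n \<longrightarrow> u < sum (x i) {1..m i}))"
      by (simp only: cell cong: ball_cong)
    also have "\<dots> \<longleftrightarrow> x \<in> (\<Pi>\<^sub>E i\<in>{1..d}. simplex_cell n u (m i))"
      unfolding chart_in_prob_tuples_iff[OF n] spaceL PiE_iff simplex_cell_def mem_Collect_eq by blast
    finally show "x \<in> chart d n -` ?A \<inter> space ?L \<longleftrightarrow> x \<in> (\<Pi>\<^sub>E i\<in>{1..d}. simplex_cell n u (m i))" .
  qed
  moreover have "emeasure ?L (\<Pi>\<^sub>E i\<in>{1..d}. simplex_cell n u (m i))
      = (\<Prod>i\<in>{1..d}. emeasure ?R (simplex_cell n u (m i)))"
    unfolding chart_lebesgue_def
    by (intro product_sigma_finite.emeasure_PiM[OF product_sigma_finite_rows] sets_simplex_cell mi) auto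
  moreover have "\<dots> = (\<Prod>i\<in>{1..d}. ennreal (Bernstein (n - 1) (m i - 1) u / fact (n - 1)))"
    using mi u by (intro prod.cong refl emeasure_simplex_cell) auto
  moreover have "\<dots> = ennreal (\<Prod>i\<in>{1..d}. Bernstein (n - 1) (m i - 1) u / fact (n - 1))"
    using u by (intro prod_ennreal) (auto intro!: divide_nonneg_nonneg Bernstein_nonneg)
  ultimately have "emeasure (uniform_prob_tuples d n) ?A
      = ennreal (\<Prod>i\<in>{1..d}. Bernstein (n - 1) (m i - 1) u / fact (n - 1))
        / ennreal (\<Prod>i\<in>{1..d}. 1 / fact (n - 1))"
    using emeasure_uniform_prob_tuples[OF n A] total by simp
  also have "\<dots> = ennreal ((\<Prod>i\<in>{1..d}. Bernstein (n - 1) (m i - 1) u / fact (n - 1))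
        / (\<Prod>i\<in>{1..d}. 1 / fact (n - 1)))"
    using u by (intro divide_ennreal prod_nonneg prod_pos)
      (auto intro!: divide_nonneg_nonneg Bernstein_nonneg)
  also have "(\<Prod>i\<in>{1..d}. Bernstein (n - 1) (m i - 1) u / fact (n - 1)) / (\<Prod>i\<in>{1..d}. 1 / fact (n - 1))
      = cell_prob d (\<lambda>_. n) m u"
    unfolding cell_prob_def prod_dividef[symmetric] by simp
  finally show ?thesis .
qed

section \<open>Expectation by exchanging the integrals\<close>

lemma expectation_comonotone:
  assumes n: "n \<ge> 1" and m: "m \<in> multi_indices d n"
  shows "has_bochner_integral (uniform_prob_tuples d n) (\<lambda>\<mu>. comonotone d \<mu> m)
    (integral {0..1} (cell_prob d (\<lambda>_. n) m))"
proof -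
  let ?M = "uniform_prob_tuples d n"
  let ?P = "cell_prob d (\<lambda>_. n) m"
  interpret M: prob_space ?M by (rule prob_space_uniform_prob_tuples[OF n])
  interpret pair_sigma_finite ?M "lborel :: real measure" ..
  \<comment> \<open>The section of G at a tuple has the comonotone mass of m as its length; the
    section at u has the cell probability as its measure. Tonelli equates their integrals.\<close>
  define G where "G = {(\<mu>, u). \<mu> \<in> prob_tuples d n \<and> u \<in> quantile_cell d \<mu> m}"
  have G: "G \<in> sets (?M \<Otimes>\<^sub>M lborel)" unfolding G_def by (rule sets_quantile_graph[OF m])
  have P0: "?P u \<ge> 0" if "u \<in> {0..1}" for u
    unfolding cell_prob_def using that by (intro prod_nonneg) (auto intro: Bernstein_nonneg)
  have fin: "emeasure lborel (quantile_cell d \<mu> m) \<noteq> \<infinity>" for \<mu>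
  proof -
    have "emeasure lborel (quantile_cell d \<mu> m) \<le> emeasure lborel {0<..<1 :: real}"
      by (intro emeasure_mono quantile_cell_subset) simp
    then show ?thesis by (auto simp: top_unique)
  qed
  have como: "ennreal (comonotone d \<mu> m) = emeasure lborel (Pair \<mu> -` G)" if "\<mu> \<in> space ?M" for \<mu>
  proof -
    have "Pair \<mu> -` G = quantile_cell d \<mu> m"
      using that by (auto simp: G_def space_uniform_prob_tuples)
    then show ?thesis
      using emeasure_eq_ennreal_measure[of lborel "quantile_cell d \<mu> m"] fin[of \<mu>]
      by (simp add: comonotone_def)
  qed
  have "(\<lambda>\<mu>. enn2real (emeasure lborel (Pair \<mu> -` G))) \<in> borel_measurable ?M"
    using measurable_emeasure_Pair1[OF G] by simp
  moreover have "comonotone d \<mu> m = enn2real (emeasure lborel (Pair \<mu> -` G))" if "\<mu> \<in> space ?M" for \<mu>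
    using como[OF that] by (metis comonotone_nonneg enn2real_ennreal)
  ultimately have meas: "(\<lambda>\<mu>. comonotone d \<mu> m) \<in> borel_measurable ?M"
    by (simp cong: measurable_cong)
  have "(\<integral>\<^sup>+\<mu>. ennreal (comonotone d \<mu> m) \<partial>?M) = (\<integral>\<^sup>+\<mu>. emeasure lborel (Pair \<mu> -` G) \<partial>?M)"
    by (intro nn_integral_cong como)
  also have "\<dots> = (\<integral>\<^sup>+u. emeasure ?M ((\<lambda>\<mu>. (\<mu>, u)) -` G) \<partial>lborel)"
    unfolding lborel.emeasure_pair_measure_alt[OF G, symmetric] by (rule emeasure_pair_measure_alt2[OF G])
  also have "\<dots> = (\<integral>\<^sup>+u. ennreal (indicator {0<..<1} u * ?P u) \<partial>lborel)"
  proof (intro nn_integral_cong)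
    fix u :: real
    have "(\<lambda>\<mu>. (\<mu>, u)) -` G = {\<mu> \<in> prob_tuples d n. u \<in> quantile_cell d \<mu> m}"
      by (auto simp: G_def)
    moreover have "emeasure ?M {\<mu> \<in> prob_tuples d n. u \<in> quantile_cell d \<mu> m}
        = ennreal (indicator {0<..<1} u * ?P u)"
    proof (cases "u \<in> {0<..<1}")
      case True
      then show ?thesis using emeasure_quantile_cell[OF n m True] by simp
    next
      case False
      then have "{\<mu> \<in> prob_tuples d n. u \<in> quantile_cell d \<mu> m} = {}"
        by (auto simp: quantile_cell_def)
      then show ?thesis using False by (simp only: emeasure_empty) simp
    qed
    ultimately show "emeasure ?M ((\<lambda>\<mu>. (\<mu>, u)) -` G) = ennreal (indicator {0<..<1} u * ?P u)"
      by simp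
  qed
  also have "\<dots> = ennreal (integral {0..1} ?P)"
  proof -
    have "(?P has_integral integral {0..1} ?P) {0..1}"
      by (intro integrable_integral integrable_continuous_real continuous_intros)
    then have "(?P has_integral integral {0..1} ?P) {0<..<1}"
      by (simp add: has_integral_Icc_iff_Ioo)
    then show ?thesis
      by (intro nn_integral_has_integral_lebesgue) (auto intro: P0)
  qed
  finally have "(\<integral>\<^sup>+\<mu>. ennreal (comonotone d \<mu> m) \<partial>?M) = ennreal (integral {0..1} ?P)" .
  moreover have "integral {0..1} ?P \<ge> 0"
    by (intro integral_nonneg integrable_continuous_real continuous_intros P0)
  ultimately show ?thesis
    using meas by (intro has_bochner_integral_nn_integral) (auto intro: comonotone_nonneg)
qed

theorem theorem5p3:
  fixes d n :: nat
  assumes "d \<ge> 1" and "n \<ge> 1"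
  shows "integrable (uniform_prob_tuples d n) (EMD d n)
    \<and> prob_space.expectation (uniform_prob_tuples d n) (EMD d n) = emd_recursion d (\<lambda>i. n)"
proof -
  have "has_bochner_integral (uniform_prob_tuples d n)
      (\<lambda>\<mu>. \<Sum>m\<in>multi_indices d n. emd_cost d m * comonotone d \<mu> m)
      (\<Sum>m\<in>multi_indices d n. emd_cost d m * integral {0..1} (cell_prob d (\<lambda>_. n) m))"
    using assms(2) by (intro has_bochner_integral_sum has_bochner_integral_mult_right expectation_comonotone)
  also have "(\<Sum>m\<in>multi_indices d n. emd_cost d m * integral {0..1} (cell_prob d (\<lambda>_. n) m))
      = emd_recursion d (\<lambda>i. n)"
    using assms(2) by (intro emd_recursion_eq_integral[symmetric]) auto
  \<comment> \<open>The formula for \<open>EMD\<close> holds on \<open>prob_tuples d n\<close>,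
    which is the whole space of the measure.\<close>
  finally have "has_bochner_integral (uniform_prob_tuples d n) (EMD d n) (emd_recursion d (\<lambda>i. n))"
    by (subst has_bochner_integral_cong[OF refl _ refl])
       (auto simp: space_uniform_prob_tuples EMD_eq_comonotone[OF _ assms(1)])
  then show ?thesis by (simp add: has_bochner_integral_iff)
qed

end
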